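(* Let $\alpha,\beta$ be dotted compositions. Then for any superpermutations $I$ and $J$ with $\gamma(I)=\alpha$ and $\gamma(J)=\beta$, $$L_\alpha L_\beta=\sum_{K\in\operatorname{SSh}(I,J)}\operatorname{sgn}(K)\,L_{\gamma(K)},$$ and the right-hand side depends only on $\alpha$ and $\beta$.
   Context: Commutative setting: $\mathbb{Q}^\theta[[x]]$ is the algebra of bounded-degree formal power series in $x_1,x_2,\ldots$ and $\theta_1,\theta_2,\ldots$ with $x_ix_j=x_jx_i$, $x_i\theta_j=\theta_jx_i$, $\theta_i\theta_j=-\theta_j\theta_i$. A dotted composition is a finite sequence $\alpha=(\alpha_1,\ldots,\alpha_k)$ with each $\alpha_i$ either a positive integer $a$ or a dotted nonnegative integer $\dot a$; write $\underline{\alpha}_i=a$ and $\bar\alpha_i=0$ in the first case, $\underline{\alpha}_i=a,\bar\alpha_i=1$ in the second. $M_\alpha=\sum_{i_1<\cdots<i_k}\theta_{i_1}^{\bar\alpha_1}\cdots\theta_{i_k}^{\bar\alpha_k}x_{i_1}^{\underline\alpha_1}\cdots x_{i_k}^{\underline\alpha_k}$. Partial order on dotted compositions: $\beta$ covers $\alpha=(\alpha_1,\ldots,\alpha_k)$ if for some $i$, $\alpha_i,\alpha_{i+1}$ are both undotted and $\beta=(\alpha_1,\ldots,\alpha_{i-1},\alpha_i+\alpha_{i+1},\alpha_{i+2},\ldots,\alpha_k)$; $\preceq$ is the reflexive-transitive closure. $L_\alpha=\sum_{\beta\preceq\alpha}M_\beta$. A set supercomposition of bidegree $(n,m)$ is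 a sequence $I=(I_1,\ldots,I_h)$ of nonempty subsets of $\{0,\ldots,n\}$ with $I_i\cap I_j\subseteq\{0\}$ for $i\ne j$, $\bigcup(I_i\setminus\{0\})=[n]$, and $m$ fermionic blocks (blocks containing $0$). A superpermutation is one whose non-fermionic blocks are singletons. For a superpermutation $I$: a non-fermionic segment is a maximal interval $[p,q]$ of indices with $I_p,\ldots,I_q$ non-fermionic, $I_i=\{a_i\}$; if $d_1<\cdots<d_s$ are the $d\in[q-p]$ with $a_{p+d-1}>a_{p+d}$, put $\alpha_{[p,q]}=(d_1,d_2-d_1,\ldots,(q-p+1)-d_s)$ (or $(q-p+1)$ if $s=0$). $\gamma(I)$ is the dotted composition obtained by concatenating, in order of appearance, the part $\dot a$ with $a=|I_i|-1$ for each fermionic block $I_i$ and the composition $\alpha_{[p,q]}$ for each non-fermionic segment. Super-shuffles: let $I=(I_1,\ldots,I_h)$ have bidegree $(n,m)$ and $J=(J_1,\ldots,J_k)$; $J[n]$ adds $n$ to every positive element of every block. An $(I,J)$-shuffle is a sequence $L$ of the $h+k$ blocks of $I$ and $J[n]$ preserving the relative order within $I$ and within $J[n]$; $\varepsilon(L)$ is the number of pairs of fermionic blocks $I_i$, $J_j[n]$ with $J_j[n]$ before $I_i$ in $L$. A sequence of consecutive non-fermionic blocks $(B_1,\ldots,B_r)$ is increasing if $\max B_i<\min B_{i+1}$ for all $i$. An $(I,J)$-super-shuffle is a set supercomposition obtained from some $(I,J)$-shuffle $L$ by a (possibly empty) collection of disjoint mergers, each replacing a run $L_p,\ldots,L_q$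 of consecutive blocks of $L$ by its union, where either (1) $L_p$ is a fermionic block from $I$ and $L_{p+1},\ldots,L_q$ are blocks from $J[n]$ forming an increasing sequence, or (2) $L_q$ is a fermionic block from $J[n]$ and $L_p,\ldots,L_{q-1}$ are blocks from $I$ forming an increasing sequence. $\operatorname{SSh}(I,J)$ is the set of these, and $\operatorname{sgn}(K)=(-1)^{\varepsilon(L)}$ for the (unique) shuffle $L$ producing $K$. *)

theory Defs
  imports "HOL-Library.Poly_Mapping" "HOL-Library.FSet"
begin

section \<open>Bounded-degree power series in commuting and anticommuting variables\<close>

text \<open>
  The pair \<open>(S, a)\<close> stands for the monomial
  \<open>\<theta>\<^sub>s\<^sub>1 \<cdots> \<theta>\<^sub>s\<^sub>r x\<^sup>a\<close> with \<open>S = {s\<^sub>1 < \<dots> < s\<^sub>r}\<close>; these are the normal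
  forms of the nonzero monomials, because the relation for \<open>i = j\<close> says
  \<open>\<theta>\<^sub>i\<^sup>2 = 0\<close>. Variables are indexed by \<^typ>\<open>nat\<close>, i.e. starting from 0: only the
  order of the indices matters.
\<close>

type_synonym supermonomial = "nat fset \<times> (nat \<Rightarrow>\<^sub>0 nat)"

definition mdeg :: "supermonomial \<Rightarrow> nat" where
  "mdeg m = fcard (fst m) + (\<Sum>i\<in>Poly_Mapping.keys (snd m). Poly_Mapping.lookup (snd m) i)"

typedef superseries =
  "{f :: supermonomial \<Rightarrow> rat. \<exists>d. \<forall>m. f m \<noteq> 0 \<longrightarrow> mdeg m \<le> d}"
  morphisms coeff Abs_superseries
  by (rule exI[of _ "\<lambda>_. 0"]) auto

setup_lifting type_definition_superseries

text \<open>
  If \<open>S\<close> and \<open>T\<close> are disjoint, sorting the word \<open>\<theta>\<^sub>S \<theta>\<^sub>T\<close> takes one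
  transposition for every pair counted by \<open>inv_pairs S T\<close>; if they are not, then
  \<open>\<theta>\<^sub>S \<theta>\<^sub>T = 0\<close>.
\<close>

definition inv_pairs :: "nat fset \<Rightarrow> nat fset \<Rightarrow> nat" where
  "inv_pairs S T = card {(s, t). s |\<in>| S \<and> t |\<in>| T \<and> t < s}"

definition theta_sign :: "nat fset \<Rightarrow> nat fset \<Rightarrow> rat" where
  "theta_sign S T = (-1) ^ inv_pairs S T"

definition mfactors :: "supermonomial \<Rightarrow> (supermonomial \<times> supermonomial) set" where
  "mfactors m = {(u, v). fst u |\<inter>| fst v = {||} \<and> fst u |\<union>| fst v = fst m
                         \<and> snd u + snd v = snd m}"

definition mmul :: "supermonomial \<Rightarrow> supermonomial \<Rightarrow> supermonomial" where
  "mmul u v = (fst u |\<union>| fst v, snd u + snd v)"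

definition mdisj :: "supermonomial \<Rightarrow> supermonomial \<Rightarrow> bool" where
  "mdisj u v \<longleftrightarrow> fst u |\<inter>| fst v = {||}"

lemma mfactors_iff: "(u, v) \<in> mfactors m \<longleftrightarrow> mdisj u v \<and> m = mmul u v"
  by (cases m) (auto simp: mfactors_def mdisj_def mmul_def)

lemma mmul_assoc: "mmul (mmul u v) w = mmul u (mmul v w)"
  by (simp add: mmul_def add.assoc funion_assoc)

lemma mdisj_mmul:
  "mdisj (mmul u v) w \<longleftrightarrow> mdisj u w \<and> mdisj v w"
  "mdisj u (mmul v w) \<longleftrightarrow> mdisj u v \<and> mdisj u w"
  by (auto simp: mdisj_def mmul_def)

lemma mdeg_superset:
  assumes "finite A" "Poly_Mapping.keys (snd m) \<subseteq> A"
  shows "mdeg m = fcard (fst m) + (\<Sum>i\<in>A. Poly_Mapping.lookup (snd m) i)"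
  unfolding mdeg_def using assms
  by (auto intro!: sum.mono_neutral_left simp: in_keys_iff)

lemma mdeg_mfactors:
  assumes "(u, v) \<in> mfactors m"
  shows "mdeg m = mdeg u + mdeg v"
proof -
  define A where "A = Poly_Mapping.keys (snd u) \<union> Poly_Mapping.keys (snd v)"
  have uv: "fst u |\<inter>| fst v = {||}" "fst m = fst u |\<union>| fst v" "snd m = snd u + snd v"
    using assms by (auto simp: mfactors_def)
  have fin: "finite A" by (simp add: A_def)
  have sub: "Poly_Mapping.keys (snd u) \<subseteq> A" "Poly_Mapping.keys (snd v) \<subseteq> A" "Poly_Mapping.keys (snd m) \<subseteq> A"
    using keys_add[of "snd u" "snd v"] by (auto simp: A_def uv)
  have "fcard (fst m) = fcard (fst u) + fcard (fst v)"
    using fcard_funion_finter[of "fst u" "fst v"] uv(1,2) by simp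
  then show ?thesis
    by (simp add: mdeg_superset[OF fin sub(1)] mdeg_superset[OF fin sub(2)]
        mdeg_superset[OF fin sub(3)] uv lookup_add sum.distrib)
qed

lemma finite_poly_mapping_le:
  fixes c :: "nat \<Rightarrow>\<^sub>0 nat"
  shows "finite {a. \<exists>b. a + b = c}"
proof (rule finite_subset)
  define N where "N = (\<Sum>i\<in>Poly_Mapping.keys c. Poly_Mapping.lookup c i)"
  let ?S = "{f. \<forall>x. (x \<in> Poly_Mapping.keys c \<longrightarrow> f x \<in> {..N}) \<and>
                    (x \<notin> Poly_Mapping.keys c \<longrightarrow> f x = (0::nat))}"
  show "{a. \<exists>b. a + b = c} \<subseteq> Poly_Mapping.lookup -` ?S \<inter> UNIV"
  proof
    fix a assume "a \<in> {a. \<exists>b. a + b = c}"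
    then obtain b where "c = a + b" by auto
    then have le: "Poly_Mapping.lookup a x \<le> Poly_Mapping.lookup c x" for x
      by (simp add: lookup_add)
    have "Poly_Mapping.lookup c x \<le> N" if "x \<in> Poly_Mapping.keys c" for x
      unfolding N_def using that by (intro member_le_sum) auto
    with le have "Poly_Mapping.lookup a x \<le> N" if "x \<in> Poly_Mapping.keys c" for x
      using that le_trans by blast
    moreover have "Poly_Mapping.lookup a x = 0" if "x \<notin> Poly_Mapping.keys c" for x
      using le[of x] that by (simp add: in_keys_iff)
    ultimately show "a \<in> Poly_Mapping.lookup -` ?S \<inter> UNIV" by simp
  qed
  have "finite ?S" by (intro finite_set_of_finite_funs) auto
  then show "finite (Poly_Mapping.lookup -` ?S \<inter> UNIV)"
    by (rule finite_vimage_IntI) (simp add: inj_on_def poly_mapping.lookup_inject)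
qed

lemma finite_fsubsets: "finite {S. S |\<subseteq>| (T :: 'a fset)}"
proof (rule finite_imageD)
  show "finite (fset ` {S. S |\<subseteq>| T})"
    by (rule finite_subset[of _ "Pow (fset T)"]) (auto simp: less_eq_fset.rep_eq)
qed (simp add: inj_on_def fset_inject)

lemma finite_mfactors [simp]: "finite (mfactors m)"
proof -
  let ?A = "{S. S |\<subseteq>| fst m} \<times> {a. \<exists>b. a + b = snd m}"
  have fin: "finite ?A"
    by (intro finite_cartesian_product finite_fsubsets finite_poly_mapping_le)
  have sub: "mfactors m \<subseteq> ?A \<times> ?A"
  proof (rule subrelI)
    fix u v assume uv: "(u, v) \<in> mfactors m"
    have 1: "fst m = fst u |\<union>| fst v" "snd u + snd v = snd m" "snd v + snd u = snd m"
      using uv by (simp_all add: mfactors_def add.commute)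
    have "u \<in> ?A" unfolding mem_Times_iff using 1(2) by (simp only: mem_Collect_eq 1(1)) blast
    moreover have "v \<in> ?A" unfolding mem_Times_iff using 1(3) by (simp only: mem_Collect_eq 1(1)) blast
    ultimately show "(u, v) \<in> ?A \<times> ?A" by (rule SigmaI)
  qed
  show ?thesis by (rule finite_subset[OF sub finite_cartesian_product[OF fin fin]])
qed

lemma sum_nonzeroE:
  assumes "(\<Sum>x\<in>A. f x) \<noteq> (0::'a::comm_monoid_add)"
  obtains x where "x \<in> A" "f x \<noteq> 0"
  using assms by (meson sum.neutral)

instantiation superseries :: ab_group_add
begin

lift_definition zero_superseries :: superseries is "\<lambda>_. 0" by simp

lift_definition plus_superseries :: "superseries \<Rightarrow> superseries \<Rightarrow> superseries"
  is "\<lambda>f g m. f m + g m"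
proof clarify
  fix f g :: "supermonomial \<Rightarrow> rat" and d e
  assume "\<forall>m. f m \<noteq> 0 \<longrightarrow> mdeg m \<le> d" "\<forall>m. g m \<noteq> 0 \<longrightarrow> mdeg m \<le> e"
  then have "mdeg m \<le> max d e" if "f m + g m \<noteq> 0" for m
    using that by (cases m, cases "f m = 0") (auto simp: le_max_iff_disj)
  then show "\<exists>d. \<forall>m. f m + g m \<noteq> 0 \<longrightarrow> mdeg m \<le> d" by blast
qed

lift_definition uminus_superseries :: "superseries \<Rightarrow> superseries"
  is "\<lambda>f m. - f m" by simp

definition minus_superseries :: "superseries \<Rightarrow> superseries \<Rightarrow> superseries" where
  "minus_superseries f g = f + - g"

instance
proof
  fix f g h :: superseries
  show "f + g + h = f + (g + h)" by transfer (simp add: fun_eq_iff)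
  show "f + g = g + f" by transfer (simp add: fun_eq_iff)
  show "0 + f = f" by transfer simp
  show "- f + f = 0" by transfer simp
  show "f - g = f + - g" by (fact minus_superseries_def)
qed

end

lemma inv_pairs_union_left:
  assumes "S |\<inter>| T = {||}"
  shows "inv_pairs (S |\<union>| T) U = inv_pairs S U + inv_pairs T U"
proof -
  let ?P = "\<lambda>S. {(s, t). s |\<in>| S \<and> t |\<in>| U \<and> t < s}"
  have fin: "finite (?P S)" for S
    by (rule finite_subset[of _ "fset S \<times> fset U"]) auto
  have "?P (S |\<union>| T) = ?P S \<union> ?P T" "?P S \<inter> ?P T = {}" using assms by auto
  then show ?thesis unfolding inv_pairs_def by (simp add: card_Un_disjoint fin)
qed

lemma inv_pairs_union_right:
  assumes "S |\<inter>| T = {||}"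
  shows "inv_pairs U (S |\<union>| T) = inv_pairs U S + inv_pairs U T"
proof -
  let ?P = "\<lambda>S. {(s, t). s |\<in>| U \<and> t |\<in>| S \<and> t < s}"
  have fin: "finite (?P S)" for S
    by (rule finite_subset[of _ "fset U \<times> fset S"]) auto
  have "?P (S |\<union>| T) = ?P S \<union> ?P T" "?P S \<inter> ?P T = {}" using assms by auto
  then show ?thesis unfolding inv_pairs_def by (simp add: card_Un_disjoint fin)
qed

lemma inv_pairs_empty [simp]: "inv_pairs {||} S = 0" "inv_pairs S {||} = 0"
  by (simp_all add: inv_pairs_def)

lemma theta_sign_empty [simp]: "theta_sign {||} S = 1" "theta_sign S {||} = 1"
  by (simp_all add: theta_sign_def)

lemma theta_sign_assoc:
  assumes "S |\<inter>| T = {||}" "T |\<inter>| U = {||}"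
  shows "theta_sign (S |\<union>| T) U * theta_sign S T = theta_sign S (T |\<union>| U) * theta_sign T U"
  using assms by (simp add: theta_sign_def inv_pairs_union_left inv_pairs_union_right power_add)

instantiation superseries :: ring_1
begin

lift_definition one_superseries :: superseries is "\<lambda>m. if m = ({||}, 0) then 1 else 0"
  by auto

lift_definition times_superseries :: "superseries \<Rightarrow> superseries \<Rightarrow> superseries"
  is "\<lambda>f g m. \<Sum>(u, v)\<in>mfactors m. theta_sign (fst u) (fst v) * f u * g v"
proof clarify
  fix f g :: "supermonomial \<Rightarrow> rat" and d e
  assume d: "\<forall>m. f m \<noteq> 0 \<longrightarrow> mdeg m \<le> d" and e: "\<forall>m. g m \<noteq> 0 \<longrightarrow> mdeg m \<le> e"
  show "\<exists>d. \<forall>m. (\<Sum>(u, v)\<in>mfactors m. theta_sign (fst u) (fst v) * f u * g v) \<noteq> 0 \<longrightarrow> mdeg m \<le> d"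
  proof (intro exI[of _ "d + e"] allI impI)
    fix m assume "(\<Sum>(u, v)\<in>mfactors m. theta_sign (fst u) (fst v) * f u * g v) \<noteq> 0"
    then obtain u v where uv: "(u, v) \<in> mfactors m" "f u \<noteq> 0" "g v \<noteq> 0"
      by (elim sum_nonzeroE) auto
    show "mdeg m \<le> d + e"
      using mdeg_mfactors[OF uv(1)] d[rule_format, OF uv(2)] e[rule_format, OF uv(3)] by simp
  qed
qed

instance
proof
  fix f g h :: superseries
  show "f * g * h = f * (g * h)"
  proof (transfer, rule ext)
    fix f g h :: "supermonomial \<Rightarrow> rat" and m
    let ?s = "\<lambda>u v. theta_sign (fst u) (fst v)"
    let ?A = "Sigma (mfactors m) (\<lambda>(p, w). mfactors p)"
    let ?B = "Sigma (mfactors m) (\<lambda>(u, q). mfactors q)"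
    let ?F = "\<lambda>((p, w), (u, v)). ?s p w * (?s u v * f u * g v) * h w"
    let ?G = "\<lambda>((u, q), (v, w)). ?s u q * f u * (?s v w * g v * h w)"
    let ?i = "\<lambda>((u, q), (v, w)). ((mmul u v, w), (u, v))"
    let ?j = "\<lambda>((p, w), (u, v)). ((u, mmul v w), (v, w))"
    have "(\<Sum>(p, w)\<in>mfactors m. ?s p w * (\<Sum>(u, v)\<in>mfactors p. ?s u v * f u * g v) * h w)
        = (\<Sum>a\<in>mfactors m. \<Sum>b\<in>mfactors (fst a). ?F (a, b))"
      by (intro sum.cong refl)
        (simp add: sum_distrib_left sum_distrib_right case_prod_unfold)
    also have "\<dots> = (\<Sum>x\<in>Sigma (mfactors m) (\<lambda>a. mfactors (fst a)). case x of (a, b) \<Rightarrow> ?F (a, b))"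
      by (rule sum.Sigma) auto
    also have "\<dots> = sum ?F ?A"
      by (simp add: case_prod_unfold)
    also have "\<dots> = sum ?G ?B"
    proof (rule sum.reindex_bij_witness[where i = ?i and j = ?j])
      fix x assume "x \<in> ?A"
      moreover obtain p w u v where x: "x = ((p, w), (u, v))" by (metis prod.exhaust)
      ultimately have m: "m = mmul p w" "mdisj p w" "p = mmul u v" "mdisj u v"
        by (auto simp: mfactors_iff)
      show "?i (?j x) = x" "?j x \<in> ?B"
        using m by (auto simp: x mfactors_iff mmul_assoc mdisj_mmul)
      have "fst u |\<inter>| fst v = {||}" "fst v |\<inter>| fst w = {||}"
        using m by (auto simp: mdisj_mmul) (auto simp: mdisj_def)
      from theta_sign_assoc[OF this] show "?G (?j x) = ?F x"
        by (simp add: x m(3)) (simp add: mmul_def mult.assoc mult.left_commute)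
    next
      fix x assume "x \<in> ?B"
      moreover obtain u q v w where x: "x = ((u, q), (v, w))" by (metis prod.exhaust)
      ultimately have m: "m = mmul u q" "mdisj u q" "q = mmul v w" "mdisj v w"
        by (auto simp: mfactors_iff)
      show "?j (?i x) = x" "?i x \<in> ?A"
        using m by (auto simp: x mfactors_iff mmul_assoc mdisj_mmul)
    qed
    also have "\<dots> = (\<Sum>x\<in>Sigma (mfactors m) (\<lambda>a. mfactors (snd a)). case x of (a, b) \<Rightarrow> ?G (a, b))"
      by (simp add: case_prod_unfold)
    also have "\<dots> = (\<Sum>a\<in>mfactors m. \<Sum>b\<in>mfactors (snd a). ?G (a, b))"
      by (rule sum.Sigma[symmetric]) auto
    also have "\<dots> = (\<Sum>(u, q)\<in>mfactors m. ?s u q * f u * (\<Sum>(v, w)\<in>mfactors q. ?s v w * g v * h w))"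
      by (intro sum.cong refl) (simp add: sum_distrib_left case_prod_unfold)
    finally show "(\<Sum>(p, w)\<in>mfactors m. ?s p w * (\<Sum>(u, v)\<in>mfactors p. ?s u v * f u * g v) * h w)
        = (\<Sum>(u, q)\<in>mfactors m. ?s u q * f u * (\<Sum>(v, w)\<in>mfactors q. ?s v w * g v * h w))" .
  qed
  show "(f + g) * h = f * h + g * h"
    by (transfer, rule ext) (simp add: distrib_left distrib_right sum.distrib case_prod_unfold)
  show "f * (g + h) = f * g + f * h"
    by (transfer, rule ext) (simp add: distrib_left distrib_right sum.distrib case_prod_unfold)
  show "1 * f = f"
  proof (transfer, rule ext)
    fix f :: "supermonomial \<Rightarrow> rat" and m
    have "(\<Sum>(u, v)\<in>mfactors m. theta_sign (fst u) (fst v) * (if u = ({||}, 0) then 1 else 0) * f v)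
        = (\<Sum>(u, v)\<in>{(({||}, 0) :: supermonomial, m)}. theta_sign (fst u) (fst v) * (if u = ({||}, 0) then 1 else 0) * f v)"
      by (rule sum.mono_neutral_right) (auto simp: mfactors_iff mmul_def mdisj_def split: if_splits)
    then show "(\<Sum>(u, v)\<in>mfactors m. theta_sign (fst u) (fst v) * (if u = ({||}, 0) then 1 else 0) * f v) = f m"
      by simp
  qed
  show "f * 1 = f"
  proof (transfer, rule ext)
    fix f :: "supermonomial \<Rightarrow> rat" and m
    have "(\<Sum>(u, v)\<in>mfactors m. theta_sign (fst u) (fst v) * f u * (if v = ({||}, 0) then 1 else 0))
        = (\<Sum>(u, v)\<in>{(m, ({||}, 0) :: supermonomial)}. theta_sign (fst u) (fst v) * f u * (if v = ({||}, 0) then 1 else 0))"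
      by (rule sum.mono_neutral_right) (auto simp: mfactors_iff mmul_def mdisj_def split: if_splits)
    then show "(\<Sum>(u, v)\<in>mfactors m. theta_sign (fst u) (fst v) * f u * (if v = ({||}, 0) then 1 else 0)) = f m"
      by simp
  qed
  show "(0::superseries) \<noteq> 1"
    by transfer (auto simp: fun_eq_iff)
qed

end

lift_definition smonom :: "supermonomial \<Rightarrow> superseries"
  is "\<lambda>u m :: supermonomial. if m = u then 1 else (0 :: rat)"
  by auto

definition X :: "nat \<Rightarrow> superseries" where
  "X i = smonom ({||}, Poly_Mapping.single i 1)"

definition Theta :: "nat \<Rightarrow> superseries" where
  "Theta i = smonom ({|i|}, 0)"

lemma coeff_smonom_mult:
  "coeff (smonom u * smonom v) m =
     (if mdisj u v \<and> m = mmul u v then theta_sign (fst u) (fst v) else 0)"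
proof -
  have "coeff (smonom u * smonom v) m =
      (\<Sum>p\<in>mfactors m. if p = (u, v) then theta_sign (fst u) (fst v) else 0)"
    unfolding times_superseries.rep_eq smonom.rep_eq by (intro sum.cong) (auto split: if_splits)
  then show ?thesis by (simp add: sum.delta mfactors_iff)
qed

lemma inv_pairs_singletons: "inv_pairs {|i|} {|j|} = (if j < i then 1 else 0)"
proof -
  have "{(s, t). s |\<in>| {|i|} \<and> t |\<in>| {|j|} \<and> t < s} = (if j < i then {(i, j)} else {})"
    by auto
  then show ?thesis by (simp add: inv_pairs_def)
qed

lemma X_commute: "X i * X j = X j * X i"
  by (rule coeff_inject[THEN iffD1], rule ext)
    (simp add: X_def coeff_smonom_mult mdisj_def mmul_def add.commute)

lemma X_Theta_commute: "X i * Theta j = Theta j * X i"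
  by (rule coeff_inject[THEN iffD1], rule ext)
    (simp add: X_def Theta_def coeff_smonom_mult mdisj_def mmul_def add.commute)

lemma Theta_anticommute: "Theta i * Theta j = - (Theta j * Theta i)"
  by (rule coeff_inject[THEN iffD1], rule ext)
    (auto simp: Theta_def coeff_smonom_mult uminus_superseries.rep_eq mdisj_def mmul_def
      theta_sign_def inv_pairs_singletons finsert_commute)


section \<open>Dotted compositions and the bases \<open>M\<close> and \<open>L\<close>\<close>

datatype part = Undotted nat | Dotted nat

fun part_val :: "part \<Rightarrow> nat" where
  "part_val (Undotted a) = a"
| "part_val (Dotted a) = a"

fun part_dot :: "part \<Rightarrow> nat" where
  "part_dot (Undotted a) = 0"
| "part_dot (Dotted a) = 1"

definition dotted_composition :: "part list \<Rightarrow> bool" where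
  "dotted_composition \<alpha> \<longleftrightarrow> Undotted 0 \<notin> set \<alpha>"

text \<open>The summand of \<open>M\<^sub>\<alpha>\<close> for the index sequence \<open>i\<^sub>1 < \<cdots> < i\<^sub>k\<close>.\<close>

definition M_term :: "part list \<Rightarrow> nat list \<Rightarrow> superseries" where
  "M_term \<alpha> is = prod_list (map2 (\<lambda>p i. Theta i ^ part_dot p) \<alpha> is)
                 * prod_list (map2 (\<lambda>p i. X i ^ part_val p) \<alpha> is)"

definition M_indices :: "part list \<Rightarrow> nat list set" where
  "M_indices \<alpha> = {is. length is = length \<alpha> \<and> sorted_wrt (<) is}"

definition deg_bound :: "nat \<Rightarrow> superseries \<Rightarrow> bool" where
  "deg_bound d f \<longleftrightarrow> (\<forall>m. coeff f m \<noteq> 0 \<longrightarrow> mdeg m \<le> d)"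

lemma coeff_mult_nonzeroE:
  assumes "coeff (f * g) m \<noteq> 0"
  obtains u v where "(u, v) \<in> mfactors m" "coeff f u \<noteq> 0" "coeff g v \<noteq> 0"
proof -
  obtain p where "p \<in> mfactors m"
      "(case p of (u, v) \<Rightarrow> theta_sign (fst u) (fst v) * coeff f u * coeff g v) \<noteq> 0"
    using assms unfolding times_superseries.rep_eq by (rule sum_nonzeroE)
  then show thesis by (cases p) (auto intro: that)
qed

lemma deg_bound_mult:
  assumes "deg_bound d f" "deg_bound e g"
  shows "deg_bound (d + e) (f * g)"
  unfolding deg_bound_def
proof (intro allI impI)
  fix m assume "coeff (f * g) m \<noteq> 0"
  then obtain u v where uv: "(u, v) \<in> mfactors m" "coeff f u \<noteq> 0" "coeff g v \<noteq> 0"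
    by (rule coeff_mult_nonzeroE)
  then show "mdeg m \<le> d + e"
    using assms mdeg_mfactors[OF uv(1)] unfolding deg_bound_def by (metis add_mono)
qed

lemma deg_bound_one: "deg_bound 0 1"
  by (auto simp: deg_bound_def one_superseries.rep_eq mdeg_def)

lemma deg_bound_power: "deg_bound d f \<Longrightarrow> deg_bound (k * d) (f ^ k)"
  by (induction k) (simp_all add: deg_bound_one deg_bound_mult)

lemma deg_bound_X: "deg_bound 1 (X i)"
  by (auto simp: deg_bound_def X_def smonom.rep_eq mdeg_def)

lemma deg_bound_Theta: "deg_bound 1 (Theta i)"
  by (auto simp: deg_bound_def Theta_def smonom.rep_eq mdeg_def fcard_finsert_if)

lemma deg_bound_prod_list:
  assumes "length is = length \<alpha>" "\<And>p i. deg_bound (d p) (F p i)"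
  shows "deg_bound (sum_list (map d \<alpha>)) (prod_list (map2 F \<alpha> is))"
  using assms(1)
  by (induction "is" \<alpha> rule: list_induct2) (simp_all add: deg_bound_one deg_bound_mult assms(2))

lemma deg_bound_M_term:
  assumes "length is = length \<alpha>"
  shows "deg_bound (sum_list (map part_dot \<alpha>) + sum_list (map part_val \<alpha>)) (M_term \<alpha> is)"
  unfolding M_term_def
proof (intro deg_bound_mult deg_bound_prod_list assms)
  show "deg_bound (part_dot p) (Theta i ^ part_dot p)" for p i
    using deg_bound_power[OF deg_bound_Theta] by simp
  show "deg_bound (part_val p) (X i ^ part_val p)" for p i
    using deg_bound_power[OF deg_bound_X] by simp
qed

text \<open>
  The infinite sum of series is taken coefficientwise; \<open>finite_M_support\<close> below shows that
  each of these sums of coefficients is finite.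
\<close>

lift_definition M :: "part list \<Rightarrow> superseries"
  is "\<lambda>\<alpha> m. \<Sum>is | is \<in> M_indices \<alpha> \<and> coeff (M_term \<alpha> is) m \<noteq> 0. coeff (M_term \<alpha> is) m"
proof (intro exI allI impI)
  fix \<alpha> m
  assume "(\<Sum>is | is \<in> M_indices \<alpha> \<and> coeff (M_term \<alpha> is) m \<noteq> 0. coeff (M_term \<alpha> is) m) \<noteq> 0"
  then obtain "is" where "is \<in> M_indices \<alpha>" "coeff (M_term \<alpha> is) m \<noteq> 0"
    by (elim sum_nonzeroE) auto
  then show "mdeg m \<le> sum_list (map part_dot \<alpha>) + sum_list (map part_val \<alpha>)"
    using deg_bound_M_term[of "is" \<alpha>] unfolding M_indices_def deg_bound_def by blast
qed

definition mvars :: "supermonomial \<Rightarrow> nat set" where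
  "mvars m = fset (fst m) \<union> Poly_Mapping.keys (snd m)"

lemma mvars_mfactors:
  assumes "(u, v) \<in> mfactors m"
  shows "mvars m = mvars u \<union> mvars v"
proof -
  have m: "fst m = fst u |\<union>| fst v" "snd m = snd u + snd v"
    using assms by (auto simp: mfactors_def)
  have "Poly_Mapping.keys (snd m) = Poly_Mapping.keys (snd u) \<union> Poly_Mapping.keys (snd v)"
    by (auto simp: in_keys_iff m lookup_add)
  then show ?thesis by (auto simp: mvars_def m)
qed

lemma mvars_mult:
  assumes "coeff (f * g) m \<noteq> 0"
    and "(\<forall>m. coeff f m \<noteq> 0 \<longrightarrow> i \<in> mvars m) \<or> (\<forall>m. coeff g m \<noteq> 0 \<longrightarrow> i \<in> mvars m)"
  shows "i \<in> mvars m"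
  using coeff_mult_nonzeroE[OF assms(1)] assms(2) mvars_mfactors by (metis UnI1 UnI2)

lemma mvars_power:
  assumes "\<forall>m. coeff f m \<noteq> 0 \<longrightarrow> i \<in> mvars m" "k > 0"
  shows "\<forall>m. coeff (f ^ k) m \<noteq> 0 \<longrightarrow> i \<in> mvars m"
  using assms by (cases k) (auto intro: mvars_mult)

lemma mvars_prod_list:
  assumes "f \<in> set fs" "\<forall>m. coeff f m \<noteq> 0 \<longrightarrow> i \<in> mvars m"
  shows "\<forall>m. coeff (prod_list fs) m \<noteq> 0 \<longrightarrow> i \<in> mvars m"
  using assms
proof (induction fs)
  case (Cons g fs)
  show ?case
  proof (intro allI impI)
    fix m assume "coeff (prod_list (g # fs)) m \<noteq> 0"
    then have nz: "coeff (g * prod_list fs) m \<noteq> 0" by simp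
    show "i \<in> mvars m"
      by (rule mvars_mult[OF nz]) (use Cons in auto)
  qed
qed simp

lemma finite_M_support:
  assumes "dotted_composition \<alpha>"
  shows "finite {is \<in> M_indices \<alpha>. coeff (M_term \<alpha> is) m \<noteq> 0}"
proof (rule finite_subset)
  show "finite {is. set is \<subseteq> mvars m \<and> length is = length \<alpha>}"
    by (rule finite_lists_length_eq) (simp add: mvars_def)
  show "{is \<in> M_indices \<alpha>. coeff (M_term \<alpha> is) m \<noteq> 0}
      \<subseteq> {is. set is \<subseteq> mvars m \<and> length is = length \<alpha>}"
  proof clarify
    fix "is" assume M: "is \<in> M_indices \<alpha>" "coeff (M_term \<alpha> is) m \<noteq> 0"
    then have len: "length is = length \<alpha>" by (simp add: M_indices_def)
    have "i \<in> mvars m" if i: "i \<in> set is" for i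
    proof -
      obtain p where p: "(p, i) \<in> set (zip \<alpha> is)"
        using i len by (metis in_set_impl_in_set_zip2)
      then have "p \<in> set \<alpha>" by (rule set_zip_leftD)
      with assms have pos: "part_dot p > 0 \<or> part_val p > 0"
        by (cases p) (auto simp: dotted_composition_def intro!: gr0I)
      have Th: "\<forall>m. coeff (Theta i) m \<noteq> 0 \<longrightarrow> i \<in> mvars m"
        by (auto simp: Theta_def smonom.rep_eq mvars_def)
      have X: "\<forall>m. coeff (X i) m \<noteq> 0 \<longrightarrow> i \<in> mvars m"
        by (auto simp: X_def smonom.rep_eq mvars_def)
      have 1: "\<forall>m. coeff (prod_list (map2 (\<lambda>p i. Theta i ^ part_dot p) \<alpha> is)) m \<noteq> 0 \<longrightarrow> i \<in> mvars m"
        if "part_dot p > 0"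
        by (rule mvars_prod_list[OF _ mvars_power[OF Th that]]) (use p in force)
      have 2: "\<forall>m. coeff (prod_list (map2 (\<lambda>p i. X i ^ part_val p) \<alpha> is)) m \<noteq> 0 \<longrightarrow> i \<in> mvars m"
        if "part_val p > 0"
        by (rule mvars_prod_list[OF _ mvars_power[OF X that]]) (use p in force)
      show ?thesis
        by (rule mvars_mult[OF M(2)[unfolded M_term_def]]) (use pos 1 2 in blast)
    qed
    with len show "set is \<subseteq> mvars m \<and> length is = length \<alpha>" by auto
  qed
qed

inductive dcovers :: "part list \<Rightarrow> part list \<Rightarrow> bool" where
  "0 < a \<Longrightarrow> 0 < b \<Longrightarrow>
   dcovers (xs @ Undotted (a + b) # ys) (xs @ Undotted a # Undotted b # ys)"

definition dle :: "part list \<Rightarrow> part list \<Rightarrow> bool"  (infix "\<preceq>" 50) where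
  "\<alpha> \<preceq> \<beta> \<longleftrightarrow> (\<lambda>x y. dcovers y x)\<^sup>*\<^sup>* \<alpha> \<beta>"

definition L :: "part list \<Rightarrow> superseries" where
  "L \<alpha> = (\<Sum>\<beta> | \<beta> \<preceq> \<alpha>. M \<beta>)"

lemma dcovers_invariants:
  assumes "dcovers \<beta> \<alpha>"
  shows "sum_list (map part_dot \<alpha>) = sum_list (map part_dot \<beta>)"
    "sum_list (map part_val \<alpha>) = sum_list (map part_val \<beta>)"
    "dotted_composition \<beta> \<Longrightarrow> dotted_composition \<alpha>"
  using assms by (auto simp: dotted_composition_def elim!: dcovers.cases)

lemma dle_invariants:
  assumes "\<beta> \<preceq> \<alpha>"
  shows "sum_list (map part_dot \<beta>) = sum_list (map part_dot \<alpha>) \<and>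
    sum_list (map part_val \<beta>) = sum_list (map part_val \<alpha>) \<and>
    (dotted_composition \<alpha> \<longrightarrow> dotted_composition \<beta>)"
  using assms unfolding dle_def
  by (induction rule: rtranclp_induct) (auto dest: dcovers_invariants)

lemma finite_dle:
  assumes "dotted_composition \<alpha>"
  shows "finite {\<beta>. \<beta> \<preceq> \<alpha>}"
proof (rule finite_subset)
  define N where "N = sum_list (map part_dot \<alpha>) + sum_list (map part_val \<alpha>)"
  let ?P = "Undotted ` {..N} \<union> Dotted ` {..N}"
  show "finite {\<beta>. set \<beta> \<subseteq> ?P \<and> length \<beta> \<le> N}"
    by (rule finite_lists_length_le) simp
  have *: "set \<beta> \<subseteq> Undotted ` {..N} \<union> Dotted ` {..N} \<and> length \<beta> \<le> N"
    if "dotted_composition \<beta>" "N = sum_list (map part_dot \<beta>) + sum_list (map part_val \<beta>)" for \<beta> N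
    using that
  proof (induction \<beta> arbitrary: N)
    case (Cons p \<beta>)
    define N' where "N' = sum_list (map part_dot \<beta>) + sum_list (map part_val \<beta>)"
    have "set \<beta> \<subseteq> Undotted ` {..N'} \<union> Dotted ` {..N'} \<and> length \<beta> \<le> N'"
      using Cons.IH[OF _ N'_def] Cons.prems by (simp add: dotted_composition_def)
    moreover have "N = part_dot p + part_val p + N'" "0 < part_dot p + part_val p"
      using Cons.prems by (cases p; auto simp: N'_def dotted_composition_def intro!: gr0I)+
    ultimately show ?case by (cases p) fastforce+
  qed simp
  show "{\<beta>. \<beta> \<preceq> \<alpha>} \<subseteq> {\<beta>. set \<beta> \<subseteq> ?P \<and> length \<beta> \<le> N}"
  proof clarify
    fix \<beta> assume "\<beta> \<preceq> \<alpha>"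
    from dle_invariants[OF this] assms show "set \<beta> \<subseteq> ?P \<and> length \<beta> \<le> N"
      by (intro *) (auto simp: N_def)
  qed
qed


section \<open>Set supercompositions and superpermutations\<close>

definition set_supercomposition :: "nat \<Rightarrow> nat \<Rightarrow> nat set list \<Rightarrow> bool" where
  "set_supercomposition n m I \<longleftrightarrow>
     (\<forall>B\<in>set I. B \<noteq> {} \<and> B \<subseteq> {0..n}) \<and>
     (\<forall>i<length I. \<forall>j<length I. i \<noteq> j \<longrightarrow> I ! i \<inter> I ! j \<subseteq> {0}) \<and>
     (\<Union>B\<in>set I. B - {0}) = {1..n} \<and>
     card {i. i < length I \<and> 0 \<in> I ! i} = m"

definition superpermutation :: "nat \<Rightarrow> nat \<Rightarrow> nat set list \<Rightarrow> bool" where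
  "superpermutation n m I \<longleftrightarrow>
     set_supercomposition n m I \<and> (\<forall>B\<in>set I. 0 \<notin> B \<longrightarrow> is_singleton B)"

text \<open>
  The paper's \<open>d \<in> [q - p]\<close> with \<open>a\<^sub>p\<^sub>+\<^sub>d\<^sub>-\<^sub>1 > a\<^sub>p\<^sub>+\<^sub>d\<close>: the word \<open>a\<close> has
  length \<open>q - p + 1\<close>, and \<open>a ! 0\<close> is \<open>a\<^sub>p\<close>.
\<close>

definition descents :: "nat list \<Rightarrow> nat list" where
  "descents a = filter (\<lambda>d. a ! (d - 1) > a ! d) [1..<length a]"

definition segment_composition :: "nat list \<Rightarrow> part list" where
  "segment_composition a =
     map2 (\<lambda>d d'. Undotted (d' - d)) (0 # descents a) (descents a @ [length a])"

function gamma :: "nat set list \<Rightarrow> part list" where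
  "gamma [] = []"
| "0 \<in> B \<Longrightarrow> gamma (B # Bs) = Dotted (card B - 1) # gamma Bs"
| "0 \<notin> B \<Longrightarrow> gamma (B # Bs) =
     segment_composition (map the_elem (takeWhile (\<lambda>C. 0 \<notin> C) (B # Bs)))
     @ gamma (dropWhile (\<lambda>C. 0 \<notin> C) (B # Bs))"
  by (auto, metis list.exhaust)
termination
  by (relation "measure length") (auto simp: length_dropWhile_le le_imp_less_Suc)


section \<open>Super-shuffles\<close>

definition shift_block :: "nat \<Rightarrow> nat set \<Rightarrow> nat set" where
  "shift_block n B = (\<lambda>a. if a = 0 then 0 else a + n) ` B"

text \<open>
  Blocks of a shuffle of \<open>I\<close> and \<open>J[n]\<close>, and blocks of a super-shuffle, carry the
  sequence they come from. A block created by a merger contains exactly one fermionic block and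
  carries the origin of that one. Without the origins a fermionic block \<open>{0}\<close> of \<open>I\<close>
  could not be told apart from a fermionic block \<open>{0}\<close> of \<open>J[n]\<close>: for \<open>I = J = ({0})\<close>
  both shuffles would give the same sequence, with opposite signs, and neither the sign of
  \<open>({0}, {0})\<close> nor the shuffle it comes from would be determined.
\<close>

datatype origin = FromI | FromJ

type_synonym block = "origin \<times> nat set"

definition IJ_shuffles :: "nat \<Rightarrow> nat set list \<Rightarrow> nat set list \<Rightarrow> block list set" where
  "IJ_shuffles n I J = shuffles (map (Pair FromI) I) (map (Pair FromJ) (map (shift_block n) J))"

definition eps :: "block list \<Rightarrow> nat" where
  "eps Bs = card {(p, q). p < q \<and> q < length Bs \<and>
       fst (Bs ! p) = FromJ \<and> 0 \<in> snd (Bs ! p) \<and>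
       fst (Bs ! q) = FromI \<and> 0 \<in> snd (Bs ! q)}"

definition increasing :: "nat set list \<Rightarrow> bool" where
  "increasing Bs \<longleftrightarrow>
     (\<forall>B\<in>set Bs. 0 \<notin> B) \<and> successively (\<lambda>B C. Max B < Min C) Bs"

text \<open>\<open>merge_run R b\<close>: the run \<open>R\<close> of consecutive blocks is replaced by \<open>b\<close>;
  the rule \<open>keep\<close> is for the blocks outside all mergers.\<close>

inductive merge_run :: "block list \<Rightarrow> block \<Rightarrow> bool" where
  keep: "merge_run [b] b"
| mergeI: "0 \<in> F \<Longrightarrow> increasing Bs \<Longrightarrow>
    merge_run ((FromI, F) # map (Pair FromJ) Bs) (FromI, \<Union>(set (F # Bs)))"
| mergeJ: "0 \<in> F \<Longrightarrow> increasing Bs \<Longrightarrow>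
    merge_run (map (Pair FromI) Bs @ [(FromJ, F)]) (FromJ, \<Union>(set (Bs @ [F])))"

definition merges_to :: "block list \<Rightarrow> block list \<Rightarrow> bool" where
  "merges_to S K \<longleftrightarrow> (\<exists>Rs. concat Rs = S \<and> list_all2 merge_run Rs K)"

definition SSh :: "nat \<Rightarrow> nat set list \<Rightarrow> nat set list \<Rightarrow> block list set" where
  "SSh n I J = {K. \<exists>S\<in>IJ_shuffles n I J. merges_to S K}"

definition ssgn :: "nat \<Rightarrow> nat set list \<Rightarrow> nat set list \<Rightarrow> block list \<Rightarrow> int" where
  "ssgn n I J K = (-1) ^ eps (THE S. S \<in> IJ_shuffles n I J \<and> merges_to S K)"

definition blocks :: "block list \<Rightarrow> nat set list" where
  "blocks K = map snd K"

text \<open>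
  For superpermutations, \<open>SSh n I J\<close> is finite and the description in \<^const>\<open>ssgn\<close>
  determines the shuffle.
\<close>

definition wf_block :: "nat \<Rightarrow> block \<Rightarrow> bool" where
  "wf_block n b \<longleftrightarrow> finite (snd b) \<and>
     (if fst b = FromI then snd b \<subseteq> {..n} else snd b \<inter> {1..n} = {}) \<and>
     (0 \<notin> snd b \<longrightarrow> is_singleton (snd b))"

definition split_block :: "nat \<Rightarrow> block \<Rightarrow> block list" where
  "split_block n b =
     (if 0 \<notin> snd b then [b]
      else if fst b = FromI then
        (FromI, snd b \<inter> {..n}) # map (\<lambda>a. (FromJ, {a})) (sorted_list_of_set (snd b - {..n}))
      else
        map (\<lambda>a. (FromI, {a})) (sorted_list_of_set (snd b \<inter> {1..n})) @ [(FromJ, snd b - {1..n})])"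

lemma increasing_singletons:
  assumes "increasing Bs" "\<forall>B\<in>set Bs. is_singleton B"
  shows "map (\<lambda>a. {a}) (sorted_list_of_set (\<Union>(set Bs))) = Bs"
proof -
  define as where "as = map the_elem Bs"
  have Bs: "Bs = map (\<lambda>a. {a}) as"
    using assms(2) by (auto simp: as_def is_singleton_the_elem intro!: map_idI[symmetric])
  have "successively (<) as"
    using assms(1) by (simp add: increasing_def Bs successively_map)
  then have "sorted_wrt (<) as"
    by (simp add: successively_conv_sorted_wrt)
  moreover have "\<Union>(set Bs) = set as" by (auto simp: Bs)
  ultimately show ?thesis
    by (simp add: Bs sorted_list_of_set.idem_if_sorted_distinct strict_sorted_iff)
qed

lemma merge_run_split:
  assumes "merge_run R b" "\<forall>c\<in>set R. wf_block n c"
  shows "split_block n b = R"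
  using assms
proof cases
  case keep
  then have wf: "wf_block n b" using assms(2) by simp
  show ?thesis
  proof (cases "fst b = FromI")
    case True
    then have "snd b \<inter> {..n} = snd b" "snd b - {..n} = {}"
      using wf by (auto simp: wf_block_def)
    with True keep show ?thesis by (cases b) (simp only: split_block_def, simp)
  next
    case False
    then have "snd b \<inter> {1..n} = {}" using wf by (simp add: wf_block_def)
    moreover from this have "snd b - {1..n} = snd b" by blast
    moreover have "fst b = FromJ" using False by (cases "fst b") simp_all
    ultimately show ?thesis using keep by (cases b) (simp only: split_block_def, simp)
  qed
next
  case (mergeI F Bs)
  have F: "F \<subseteq> {..n}" using assms(2) mergeI by (simp add: wf_block_def)
  have Bs: "\<forall>B\<in>set Bs. is_singleton B \<and> 0 \<notin> B \<and> B \<inter> {1..n} = {}"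
    using assms(2) mergeI by (auto simp: wf_block_def increasing_def)
  have B: "B \<inter> {..n} = {}" if "B \<in> set Bs" for B
  proof -
    have "{..n} = insert 0 {1..n}" by auto
    then show ?thesis using Bs that by simp
  qed
  have "\<Union>(set (F # Bs)) \<inter> {..n} = F" "\<Union>(set (F # Bs)) - {..n} = \<Union>(set Bs)"
    using F B by fastforce+
  moreover have "map (\<lambda>a. (FromJ, {a})) (sorted_list_of_set (\<Union>(set Bs))) = map (Pair FromJ) Bs"
    using arg_cong[OF increasing_singletons[OF mergeI(4)], of "map (Pair FromJ)"] Bs
    by (simp add: o_def)
  ultimately show ?thesis using mergeI by (simp add: split_block_def)
next
  case (mergeJ F Bs)
  have F: "F \<inter> {1..n} = {}" using assms(2) mergeJ by (simp add: wf_block_def)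
  have Bs: "\<forall>B\<in>set Bs. is_singleton B \<and> 0 \<notin> B \<and> B \<subseteq> {..n}"
    using assms(2) mergeJ by (auto simp: wf_block_def increasing_def)
  have B: "B \<subseteq> {1..n}" if "B \<in> set Bs" for B
  proof
    fix a assume "a \<in> B"
    then have "a \<noteq> 0" "a \<le> n" using Bs that by auto
    then show "a \<in> {1..n}" by simp
  qed
  have "\<Union>(set (Bs @ [F])) \<inter> {1..n} = \<Union>(set Bs)" "\<Union>(set (Bs @ [F])) - {1..n} = F"
    using F B by fastforce+
  moreover have "map (\<lambda>a. (FromI, {a})) (sorted_list_of_set (\<Union>(set Bs))) = map (Pair FromI) Bs"
    using arg_cong[OF increasing_singletons[OF mergeJ(4)], of "map (Pair FromI)"] Bs
    by (simp add: o_def)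
  ultimately show ?thesis using mergeJ by (simp add: split_block_def)
qed

lemma merges_to_split:
  assumes "merges_to S K" "\<forall>c\<in>set S. wf_block n c"
  shows "S = concat (map (split_block n) K)"
proof -
  obtain Rs where Rs: "concat Rs = S" "list_all2 merge_run Rs K"
    using assms(1) by (auto simp: merges_to_def)
  have "concat Rs = concat (map (split_block n) K)"
    if "list_all2 merge_run Rs K" "\<forall>c\<in>set (concat Rs). wf_block n c" for Rs
    using that by (induction) (simp_all add: merge_run_split)
  from this[OF Rs(2)] show ?thesis using Rs(1) assms(2) by simp
qed

lemma superpermutation_block:
  assumes "superpermutation n m I" "B \<in> set I"
  shows "B \<subseteq> {..n}" "finite B" "0 \<notin> B \<Longrightarrow> is_singleton B"
proof -
  have "B \<subseteq> {0..n}" using assms by (simp add: superpermutation_def set_supercomposition_def)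
  then show "B \<subseteq> {..n}" by auto
  then show "finite B" by (rule finite_subset) simp
  show "0 \<notin> B \<Longrightarrow> is_singleton B" using assms by (auto simp: superpermutation_def)
qed

lemma wf_block_IJ_shuffles:
  assumes "superpermutation n m I" "superpermutation n' m' J" "S \<in> IJ_shuffles n I J" "c \<in> set S"
  shows "wf_block n c"
proof -
  have "set S = Pair FromI ` set I \<union> Pair FromJ ` shift_block n ` set J"
    using set_shuffles[OF assms(3)[unfolded IJ_shuffles_def]] by (simp add: image_image)
  then consider B where "B \<in> set I" "c = (FromI, B)"
    | B where "B \<in> set J" "c = (FromJ, shift_block n B)"
    using assms(4) by auto
  then show ?thesis
  proof cases
    case 1
    then show ?thesis
      using superpermutation_block[OF assms(1)] by (auto simp: wf_block_def)
  next
    case 2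
    have "is_singleton (shift_block n B)" if "0 \<notin> shift_block n B"
    proof -
      have "0 \<notin> B" using that by (force simp: shift_block_def)
      then obtain a where "B = {a}"
        using superpermutation_block(3)[OF assms(2) 2(1)] by (auto simp: is_singleton_def)
      then show ?thesis
        by (simp only: shift_block_def image_insert image_empty is_singleton_def) blast
    qed
    moreover have "finite (shift_block n B)" "shift_block n B \<inter> {1..n} = {}"
      using superpermutation_block(2)[OF assms(2) 2(1)] by (auto simp: shift_block_def)
    ultimately show ?thesis by (simp add: wf_block_def 2)
  qed
qed

lemma SSh_unique_shuffle:
  assumes "superpermutation n m I" "superpermutation n' m' J" "K \<in> SSh n I J"
  shows "\<exists>!S. S \<in> IJ_shuffles n I J \<and> merges_to S K"
proof -
  obtain S where S: "S \<in> IJ_shuffles n I J" "merges_to S K"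
    using assms(3) by (auto simp: SSh_def)
  show ?thesis
  proof (rule ex1I)
    fix S' assume "S' \<in> IJ_shuffles n I J \<and> merges_to S' K"
    then show "S' = S"
      using merges_to_split[of _ K n] wf_block_IJ_shuffles[OF assms(1,2)] S by metis
  qed (use S in simp)
qed

lemma merges_to_bound:
  assumes "merges_to S K"
  shows "length K \<le> length S \<and> set K \<subseteq> {FromI, FromJ} \<times> Pow (\<Union>(snd ` set S))"
proof -
  have "length K \<le> length (concat Rs) \<and>
      set K \<subseteq> {FromI, FromJ} \<times> Pow (\<Union>(snd ` set (concat Rs)))"
    if "list_all2 merge_run Rs K" for Rs
    using that
  proof induction
    case (Cons R Rs b K)
    have R: "R \<noteq> []" "snd b \<subseteq> \<Union>(snd ` set R)"
      using Cons(1) by (auto elim!: merge_run.cases)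
    have "fst b \<in> {FromI, FromJ}" by (cases "fst b") auto
    with R have "b \<in> {FromI, FromJ} \<times> Pow (\<Union>(snd ` set (concat (R # Rs))))"
      unfolding mem_Times_iff by auto
    moreover have "1 \<le> length R" using R by (cases R) auto
    ultimately show ?case using Cons.IH by auto
  qed simp
  from this show ?thesis using assms unfolding merges_to_def by blast
qed

lemma finite_SSh:
  assumes "superpermutation n m I" "superpermutation n' m' J"
  shows "finite (SSh n I J)"
proof -
  have "finite {K. merges_to S K}" if "S \<in> IJ_shuffles n I J" for S
  proof (rule finite_subset)
    have "finite (\<Union>(snd ` set S))"
      using wf_block_IJ_shuffles[OF assms that] by (auto simp: wf_block_def)
    then show "finite {K. set K \<subseteq> {FromI, FromJ} \<times> Pow (\<Union>(snd ` set S)) \<and> length K \<le> length S}"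
      by (intro finite_lists_length_le) simp
    show "{K. merges_to S K}
        \<subseteq> {K. set K \<subseteq> {FromI, FromJ} \<times> Pow (\<Union>(snd ` set S)) \<and> length K \<le> length S}"
      using merges_to_bound by blast
  qed
  moreover have "finite (IJ_shuffles n I J)" by (simp add: IJ_shuffles_def finite_shuffles)
  ultimately show ?thesis by (simp add: SSh_def Collect_bex_eq)
qed

end

theory Submission
  imports Defs
begin

text \<open>
  As for \<open>P\<close>-partitions, \<open>L\<^bsub>\<gamma>(I)\<^esub>\<close> is the sum of the monomials of all
  weakly increasing index maps on the blocks of \<open>I\<close> that increase strictly at descents and next
  to fermionic blocks. Sorting such maps by the blocks sent to the smallest variable \<open>v\<close> gives
  \<open>L\<^sub>I(v, vs) = (\<Sum>P Q. wt v P * L\<^sub>Q(vs))\<close>, over \<open>I = P @ Q\<close> with \<open>P\<close> empty, a single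
  fermionic block, or an increasing run of singletons. In the product
  \<open>L\<^sub>I(v, vs) * L\<^sub>J(v, vs)\<close> the pair of first runs \<open>P\<close>, \<open>P'\<close> vanishes
  if both are fermionic, since \<open>\<theta>\<^sub>v\<^sup>2 = 0\<close>; otherwise it is exactly the first run of a
  super-shuffle, a fermionic run having absorbed the other one by a merger. Moving
  \<open>wt v P'\<close> past \<open>L\<^sub>Q(vs)\<close> produces the sign of this first run, and induction on
  the list of variables finishes the proof. As a coefficient involves only finitely many
  variables, the truncations to the variables below \<open>N\<close>, for all \<open>N\<close>, suffice.
\<close>

section \<open>Truncation to finitely many variables\<close>

lemma coeff_zero [simp]: "coeff 0 m = 0"
  by (simp add: zero_superseries.rep_eq)

lemma coeff_sum: "coeff (sum f A) m = (\<Sum>x\<in>A. coeff (f x) m)"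
  by (induction A rule: infinite_finite_induct) (simp_all add: plus_superseries.rep_eq)

definition agree :: "nat \<Rightarrow> superseries \<Rightarrow> superseries \<Rightarrow> bool" where
  "agree N f g \<longleftrightarrow> (\<forall>m. mvars m \<subseteq> {..<N} \<longrightarrow> coeff f m = coeff g m)"

lemma agree_refl [simp]: "agree N f f"
  by (simp add: agree_def)

lemma agree_sum: "(\<And>x. x \<in> A \<Longrightarrow> agree N (f x) (g x)) \<Longrightarrow> agree N (sum f A) (sum g A)"
  by (simp add: agree_def coeff_sum)

text \<open>The factors of a monomial involve only variables of that monomial, so the monomials in
  variables below \<open>N\<close> are closed under factorization.\<close>

lemma agree_mult:
  assumes "agree N f f'" "agree N g g'"
  shows "agree N (f * g) (f' * g')"
  unfolding agree_def times_superseries.rep_eq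
proof (intro allI impI sum.cong refl, clarify)
  fix m u v assume m: "mvars m \<subseteq> {..<N}" and uv: "(u, v) \<in> mfactors m"
  have "mvars u \<subseteq> {..<N}" "mvars v \<subseteq> {..<N}"
    using m mvars_mfactors[OF uv] by auto
  then show "theta_sign (fst u) (fst v) * coeff f u * coeff g v =
      theta_sign (fst u) (fst v) * coeff f' u * coeff g' v"
    using assms unfolding agree_def by metis
qed

lemma agree_eqI:
  assumes "\<And>N. agree N f g"
  shows "f = g"
proof (rule coeff_inject[THEN iffD1], rule ext)
  fix m
  have "finite (mvars m)" by (simp add: mvars_def)
  then obtain N where "mvars m \<subseteq> {..<N}"
    by (meson finite_nat_set_iff_bounded lessThan_iff subsetI)
  with assms show "coeff f m = coeff g m" unfolding agree_def by metis
qed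

section \<open>The functions M in finitely many variables\<close>

text \<open>\<open>M_term\<close> collects all thetas before all x's; here the two factors of one
  index stand together, so that products can be built one variable at a time.\<close>

definition wt :: "nat \<Rightarrow> part \<Rightarrow> superseries" where
  "wt v p = Theta v ^ part_dot p * X v ^ part_val p"

text \<open>For increasing \<open>vs\<close> this is \<open>M \<alpha>\<close> in these variables:
  either the smallest variable \<open>v\<close> is left out or it is the index of the first
  part.\<close>

primrec M_trunc :: "nat list \<Rightarrow> part list \<Rightarrow> superseries" where
  "M_trunc [] \<alpha> = (if \<alpha> = [] then 1 else 0)"
| "M_trunc (v # vs) \<alpha> =
     M_trunc vs \<alpha> + (case \<alpha> of [] \<Rightarrow> 0 | p # \<alpha>' \<Rightarrow> wt v p * M_trunc vs \<alpha>')"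

lemma X_power_commute_thetas:
  "X v ^ k * prod_list (map2 (\<lambda>p i. Theta i ^ part_dot p) \<alpha> is) =
   prod_list (map2 (\<lambda>p i. Theta i ^ part_dot p) \<alpha> is) * X v ^ k"
proof (induction \<alpha> arbitrary: "is")
  case (Cons p \<alpha>)
  have *: "X v ^ k * Theta i ^ d = Theta i ^ d * X v ^ k" for i d
    by (metis X_Theta_commute power_commuting_commutes)
  show ?case
  proof (cases "is")
    case (Cons i is')
    then show ?thesis
      using Cons.IH[of is'] *[of i "part_dot p"]
      by (simp add: mult.assoc[symmetric]) (simp add: mult.assoc)
  qed simp
qed simp

lemma M_term_Nil: "M_term [] is = 1"
  by (simp add: M_term_def)

lemma M_term_Cons: "M_term (p # \<alpha>) (i # is) = wt i p * M_term \<alpha> is"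
proof -
  let ?T = "prod_list (map2 (\<lambda>p i. Theta i ^ part_dot p) \<alpha> is)"
  let ?X = "prod_list (map2 (\<lambda>p i. X i ^ part_val p) \<alpha> is)"
  have "?T * (X i ^ part_val p * ?X) = X i ^ part_val p * (?T * ?X)"
    by (simp add: mult.assoc[symmetric] X_power_commute_thetas)
  then show ?thesis by (simp add: M_term_def wt_def mult.assoc)
qed

lemma M_trunc_Nil: "M_trunc vs [] = 1"
  by (induction vs) auto

lemma M_trunc_eq:
  assumes "sorted_wrt (<) vs"
  shows "M_trunc vs \<alpha> = (\<Sum>is | is \<in> M_indices \<alpha> \<and> set is \<subseteq> set vs. M_term \<alpha> is)"
  using assms
proof (induction vs arbitrary: \<alpha>)
  case Nil
  have "{is. is \<in> M_indices \<alpha> \<and> set is \<subseteq> set []} = (if \<alpha> = [] then {[]} else {})"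
    by (auto simp: M_indices_def)
  then show ?case by (simp add: M_term_Nil)
next
  case (Cons v vs)
  let ?S = "\<lambda>vs \<alpha>. {is. is \<in> M_indices \<alpha> \<and> set is \<subseteq> set vs}"
  have fin: "finite (?S vs \<alpha>)" for vs \<alpha>
    by (rule finite_subset[OF _ finite_lists_length_eq[of "set vs" "length \<alpha>"]])
      (auto simp: M_indices_def)
  show ?case
  proof (cases \<alpha>)
    case Nil
    then have "?S (v # vs) \<alpha> = {[]}" by (auto simp: M_indices_def)
    with Nil show ?thesis by (simp add: M_term_Nil M_trunc_Nil)
  next
    case \<alpha>: (Cons p \<alpha>')
    have v: "\<forall>i\<in>set vs. v < i" and vs: "sorted_wrt (<) vs" using Cons.prems by auto
    \<comment> \<open>As \<open>v\<close> is smallest, an index sequence that contains it must start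
      with it.\<close>
    have S: "?S (v # vs) \<alpha> = ?S vs \<alpha> \<union> (#) v ` ?S vs \<alpha>'" (is "?A = ?B \<union> ?C")
    proof
      show "?A \<subseteq> ?B \<union> ?C"
      proof
        fix "is" assume A: "is \<in> ?A"
        then obtain i js where js: "is = i # js" "length js = length \<alpha>'"
            "\<forall>j\<in>set js. i < j" "sorted_wrt (<) js"
          by (auto simp: M_indices_def \<alpha> length_Suc_conv)
        show "is \<in> ?B \<union> ?C"
        proof (cases "i = v")
          case True
          then have "js \<in> ?S vs \<alpha>'" using A js by (auto simp: M_indices_def)
          with True js show ?thesis by auto
        next
          case False
          then have "v < i" using A js v by auto
          then have "set is \<subseteq> set vs" using A js by fastforce
          with A show ?thesis by auto
        qed
      qed
      show "?B \<union> ?C \<subseteq> ?A"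
        using v by (auto simp: M_indices_def \<alpha> subset_iff)
    qed
    have disj: "?S vs \<alpha> \<inter> (#) v ` ?S vs \<alpha>' = {}"
      using v by auto
    have "sum (M_term \<alpha>) (?S (v # vs) \<alpha>) =
        sum (M_term \<alpha>) (?S vs \<alpha>) + sum (M_term \<alpha>) ((#) v ` ?S vs \<alpha>')"
      unfolding S by (intro sum.union_disjoint disj finite_imageI fin)
    also have "sum (M_term \<alpha>) ((#) v ` ?S vs \<alpha>') = wt v p * M_trunc vs \<alpha>'"
      by (simp add: sum.reindex inj_on_def Cons.IH[OF vs] sum_distrib_left M_term_Cons \<alpha>)
    finally show ?thesis by (simp add: \<alpha> Cons.IH[OF vs])
  qed
qed

lemma mvars_wt:
  assumes "p \<noteq> Undotted 0" "coeff (wt i p) m \<noteq> 0"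
  shows "i \<in> mvars m"
proof -
  have Th: "\<forall>m. coeff (Theta i) m \<noteq> 0 \<longrightarrow> i \<in> mvars m"
    by (auto simp: Theta_def smonom.rep_eq mvars_def)
  have X: "\<forall>m. coeff (X i) m \<noteq> 0 \<longrightarrow> i \<in> mvars m"
    by (auto simp: X_def smonom.rep_eq mvars_def)
  show ?thesis
    using assms mvars_power[OF Th, of "part_dot p"] mvars_power[OF X, of "part_val p"]
    unfolding wt_def by (intro mvars_mult[OF assms(2)[unfolded wt_def]]) (cases p; auto)
qed

lemma mvars_M_term:
  assumes "length is = length \<alpha>" "dotted_composition \<alpha>" "coeff (M_term \<alpha> is) m \<noteq> 0"
  shows "set is \<subseteq> mvars m"
  using assms
proof (induction "is" \<alpha> arbitrary: m rule: list_induct2)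
  case (Cons i "is" p \<alpha>)
  have "coeff (wt i p * M_term \<alpha> is) m \<noteq> 0" using Cons.prems by (simp add: M_term_Cons)
  then obtain u w where "(u, w) \<in> mfactors m" "coeff (wt i p) u \<noteq> 0" "coeff (M_term \<alpha> is) w \<noteq> 0"
    by (rule coeff_mult_nonzeroE)
  moreover have "dotted_composition \<alpha>" "p \<noteq> Undotted 0"
    using Cons.prems by (auto simp: dotted_composition_def)
  ultimately have "set is \<subseteq> mvars w" "i \<in> mvars u" "mvars m = mvars u \<union> mvars w"
    using Cons.IH mvars_wt mvars_mfactors by blast+
  then show ?case by auto
qed simp

text \<open>A part other than \<open>Undotted 0\<close> leaves its index visible in the monomial, so
  only index sequences below \<open>N\<close> contribute to the coefficients compared.\<close>

lemma agree_M_trunc: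
  assumes "dotted_composition \<alpha>"
  shows "agree N (M \<alpha>) (M_trunc [0..<N] \<alpha>)"
  unfolding agree_def
proof (intro allI impI)
  fix m assume m: "mvars m \<subseteq> {..<N}"
  have fin: "finite {is. is \<in> M_indices \<alpha> \<and> set is \<subseteq> set [0..<N]}"
    by (rule finite_subset[OF _ finite_lists_length_eq[of "set [0..<N]" "length \<alpha>"]])
      (auto simp: M_indices_def)
  have "coeff (M_trunc [0..<N] \<alpha>) m =
      (\<Sum>is | is \<in> M_indices \<alpha> \<and> set is \<subseteq> set [0..<N]. coeff (M_term \<alpha> is) m)"
    by (simp add: M_trunc_eq coeff_sum)
  also have "\<dots> = (\<Sum>is | is \<in> M_indices \<alpha> \<and> coeff (M_term \<alpha> is) m \<noteq> 0. coeff (M_term \<alpha> is) m)"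
    using m mvars_M_term[OF _ assms, of _ m]
    by (intro sum.mono_neutral_right fin) (fastforce simp: M_indices_def)+
  finally show "coeff (M \<alpha>) m = coeff (M_trunc [0..<N] \<alpha>) m"
    by (simp add: M.rep_eq)
qed

section \<open>The recursion for \<open>L\<close> along its first run\<close>

text \<open>Effect on the composition of prepending a letter that makes no descent: the first part
  grows by one. The second equation gives a default value.\<close>

fun bump :: "part list \<Rightarrow> part list" where
  "bump (Undotted k # \<alpha>) = Undotted (Suc k) # \<alpha>"
| "bump \<alpha> = \<alpha>"

lemma descents_Cons_Cons:
  "descents (a # b # as) = (if b < a then [1] else []) @ map Suc (descents (b # as))"
proof -
  let ?w = "a # b # as"
  let ?P = "\<lambda>d. ?w ! d < ?w ! (d - 1)"
  have "[1..<length ?w] = 1 # map Suc [1..<length (b # as)]"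
    unfolding map_Suc_upt by (simp add: upt_rec)
  then have "descents ?w = (if b < a then [1] else []) @ filter ?P (map Suc [1..<length (b # as)])"
    unfolding descents_def by simp
  also have "filter ?P (map Suc [1..<length (b # as)]) =
      map Suc (filter (\<lambda>d. (b # as) ! d < (b # as) ! (d - 1)) [1..<length (b # as)])"
    unfolding filter_map o_def
    by (intro arg_cong[where f = "map Suc"] filter_cong refl) (auto simp: nth_Cons split: nat.split)
  finally show ?thesis unfolding descents_def .
qed

lemma segment_composition_single: "segment_composition [a] = [Undotted 1]"
  by (simp add: segment_composition_def descents_def)

lemma map2_Suc_diff:
  "map2 (\<lambda>d d'. Undotted (d' - d)) (map Suc xs) (map Suc ys) =
   map2 (\<lambda>d d'. Undotted (d' - d)) xs ys"
  by (simp add: zip_map1 zip_map2 case_prod_unfold)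

lemma segment_composition_Cons_Cons:
  "segment_composition (a # b # as) =
     (if b < a then Undotted 1 # segment_composition (b # as)
      else bump (segment_composition (b # as)))"
proof -
  define ds where "ds = descents (b # as)"
  define l where "l = Suc (length as)"
  have seg: "segment_composition (b # as) = map2 (\<lambda>d d'. Undotted (d' - d)) (0 # ds) (ds @ [l])"
    by (simp add: segment_composition_def ds_def l_def)
  have app: "map Suc ds @ [Suc l] = map Suc (ds @ [l])" by simp
  show ?thesis
  proof (cases "b < a")
    case True
    have "segment_composition (a # b # as) =
        map2 (\<lambda>d d'. Undotted (d' - d)) (0 # map Suc (0 # ds)) (1 # map Suc (ds @ [l]))"
      using True by (simp add: segment_composition_def descents_Cons_Cons ds_def l_def)
    also have "\<dots> = Undotted 1 # map2 (\<lambda>d d'. Undotted (d' - d)) (map Suc (0 # ds)) (map Suc (ds @ [l]))"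
      by simp
    finally show ?thesis using True by (simp only: map2_Suc_diff seg if_True)
  next
    case False
    then have *: "segment_composition (a # b # as) =
        map2 (\<lambda>d d'. Undotted (d' - d)) (0 # map Suc ds) (map Suc (ds @ [l]))"
      by (simp add: segment_composition_def descents_Cons_Cons ds_def l_def)
    \<comment> \<open>\<open>ds @ [l]\<close> is never empty; its head \<open>e\<close> ends the
      first part. That end moves to \<open>Suc e\<close> while the start stays at 0, so only the
      first part grows.\<close>
    obtain e es where es: "ds @ [l] = e # es" by (cases ds) auto
    show ?thesis using False by (simp only: * seg es) (simp add: map2_Suc_diff)
  qed
qed

text \<open>Turns the recursion of \<open>gamma\<close> over whole non-fermionic segments into one
  over single blocks, as inductions on the list require.\<close>

lemma gamma_Cons:
  assumes "0 \<notin> B"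
  shows "gamma (B # Bs) =
     (if Bs \<noteq> [] \<and> 0 \<notin> hd Bs \<and> the_elem B \<le> the_elem (hd Bs) then bump (gamma Bs)
      else Undotted 1 # gamma Bs)"
proof (cases "Bs \<noteq> [] \<and> 0 \<notin> hd Bs")
  case True
  then obtain C Cs where Bs: "Bs = C # Cs" "0 \<notin> C" by (cases Bs) auto
  have "segment_composition (c # cs) \<noteq> []" for c cs
    by (simp add: segment_composition_def)
  \<comment> \<open>\<open>bump\<close> touches only the head, which lies in the nonempty segment
    composition.\<close>
  then have bump: "bump (segment_composition (c # cs) @ \<beta>) = bump (segment_composition (c # cs)) @ \<beta>"
    for c cs \<beta>
    by (cases "segment_composition (c # cs)" rule: bump.cases) simp_all
  show ?thesis
    using assms Bs by (simp add: segment_composition_Cons_Cons bump)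
next
  case False
  then show ?thesis using assms
    by (cases Bs) (auto simp: segment_composition_single)
qed

declare gamma.simps(3) [simp del]

lemma gamma_nonfermionic_head:
  assumes "Bs \<noteq> []" "0 \<notin> hd Bs"
  obtains k \<beta> where "gamma Bs = Undotted (Suc k) # \<beta>"
proof -
  have "\<exists>k \<beta>. gamma Bs = Undotted (Suc k) # \<beta>"
    using assms
  proof (induction Bs)
    case (Cons B Bs)
    then show ?case by (auto simp: gamma_Cons)
  qed simp
  then show thesis using that by blast
qed

lemma dotted_composition_gamma: "dotted_composition (gamma I)"
proof (induction I)
  case (Cons B I)
  show ?case
  proof (cases "0 \<in> B")
    case False
    show ?thesis
    proof (cases "I \<noteq> [] \<and> 0 \<notin> hd I")
      case True
      then obtain k \<beta> where "gamma I = Undotted (Suc k) # \<beta>" by (elim conjE gamma_nonfermionic_head)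
      then show ?thesis using Cons False by (auto simp: gamma_Cons dotted_composition_def)
    qed (use Cons False in \<open>auto simp: gamma_Cons dotted_composition_def\<close>)
  qed (use Cons in \<open>simp add: dotted_composition_def\<close>)
qed (simp add: dotted_composition_def)

section \<open>Refinement of dotted compositions\<close>

lemma dle_refl [simp]: "\<alpha> \<preceq> \<alpha>"
  by (simp add: dle_def)

lemma dle_trans: "\<alpha> \<preceq> \<beta> \<Longrightarrow> \<beta> \<preceq> \<gamma> \<Longrightarrow> \<alpha> \<preceq> \<gamma>"
  by (auto simp: dle_def)

lemma dcovers_Cons: "dcovers \<beta> \<alpha> \<Longrightarrow> dcovers (p # \<beta>) (p # \<alpha>)"
  by (erule dcovers.cases) (metis append_Cons dcovers.intros)

lemma dle_Cons:
  assumes "\<alpha> \<preceq> \<beta>"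
  shows "p # \<alpha> \<preceq> p # \<beta>"
  using assms unfolding dle_def
  by (induction rule: rtranclp_induct) (auto intro: rtranclp.rtrancl_into_rtrancl dcovers_Cons)

lemma dcovers_ConsE:
  assumes "dcovers (p # \<beta>) \<alpha>"
  obtains \<alpha>' where "\<alpha> = p # \<alpha>'" "dcovers \<beta> \<alpha>'"
  | a b where "0 < a" "0 < b" "p = Undotted (a + b)" "\<alpha> = Undotted a # Undotted b # \<beta>"
  using assms
proof cases
  case (1 a b xs ys)
  show ?thesis
  proof (cases xs)
    case Nil
    then show ?thesis using 1 that(2) by simp
  next
    case (Cons x xs')
    then show ?thesis using 1 that(1) dcovers.intros[of a b xs' ys] by simp
  qed
qed

text \<open>Every split stays available when the first part is enlarged: a split of the first part
  into \<open>a\<close> and \<open>b\<close> becomes one into \<open>Suc a\<close> and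
  \<open>b\<close>.\<close>

lemma dle_bump:
  assumes "\<alpha> \<preceq> Undotted k # \<beta>"
  shows "bump \<alpha> \<preceq> Undotted (Suc k) # \<beta>"
proof -
  \<comment> \<open>The claim also records that the first part of a refinement stays undotted, so
    that \<open>bump\<close> really acts on it.\<close>
  have "\<exists>j \<alpha>'. \<alpha> = Undotted j # \<alpha>' \<and> Undotted (Suc j) # \<alpha>' \<preceq> Undotted (Suc k) # \<beta>"
    using assms unfolding dle_def
  proof (induction rule: converse_rtranclp_induct)
    case (step \<alpha> \<alpha>1)
    then obtain j \<alpha>' where j: "\<alpha>1 = Undotted j # \<alpha>'"
      "(\<lambda>x y. dcovers y x)\<^sup>*\<^sup>* (Undotted (Suc j) # \<alpha>') (Undotted (Suc k) # \<beta>)" by auto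
    from step(1)[unfolded j(1)] show ?case
    proof (cases rule: dcovers_ConsE)
      case (1 \<alpha>2)
      then show ?thesis
        using j(2) by (metis converse_rtranclp_into_rtranclp dcovers_Cons)
    next
      case (2 a b)
      then have "dcovers (Undotted (Suc j) # \<alpha>') (Undotted (Suc a) # Undotted b # \<alpha>')"
        using dcovers.intros[of "Suc a" b "[]" \<alpha>'] by simp
      with 2 show ?thesis
        using j(2) by (metis converse_rtranclp_into_rtranclp)
    qed
  qed auto
  then show ?thesis by auto
qed

section \<open>Runs of blocks sharing a variable\<close>

definition run :: "nat set list \<Rightarrow> bool" where
  "run P \<longleftrightarrow> (\<exists>B. 0 \<in> B \<and> P = [B]) \<or>
     (\<forall>B\<in>set P. 0 \<notin> B) \<and> successively (\<lambda>B C. the_elem B \<le> the_elem C) P"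

definition fermionic :: "nat set list \<Rightarrow> bool" where
  "fermionic P \<longleftrightarrow> P \<noteq> [] \<and> 0 \<in> hd P"

text \<open>A fermionic block forms a run alone, so the first block tells the type of a run. The
  empty run gets \<open>Undotted 0\<close>, whose weight is 1.\<close>

definition run_part :: "nat set list \<Rightarrow> part" where
  "run_part P = (if fermionic P then Dotted (card (hd P) - 1) else Undotted (length P))"

definition splits :: "nat set list \<Rightarrow> (nat set list \<times> nat set list) set" where
  "splits I = {(P, Q). P @ Q = I \<and> run P}"

lemma run_Nil [simp]: "run []"
  by (simp add: run_def)

lemma run_Cons_nonfermionic:
  "0 \<notin> B \<Longrightarrow> run (B # P) \<longleftrightarrow>
     P = [] \<or> (run P \<and> 0 \<notin> hd P \<and> the_elem B \<le> the_elem (hd P))"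
  by (cases P) (auto simp: run_def)

lemma run_Cons_fermionic: "0 \<in> B \<Longrightarrow> run (B # P) \<longleftrightarrow> P = []"
  by (auto simp: run_def)

lemma finite_splits [simp]: "finite (splits I)"
proof (rule finite_subset)
  show "splits I \<subseteq> (\<lambda>i. (take i I, drop i I)) ` {..length I}"
  proof clarify
    fix P Q assume "(P, Q) \<in> splits I"
    then have "(P, Q) = (take (length P) I, drop (length P) I)" "length P \<le> length I"
      by (auto simp: splits_def)
    then show "(P, Q) \<in> (\<lambda>i. (take i I, drop i I)) ` {..length I}" by blast
  qed
qed simp

text \<open>A run has no inner descent, so cutting \<open>gamma (P @ Q)\<close> after
  \<open>P\<close> falls between two parts or splits one undotted part in two.\<close>

lemma run_part_gamma_dle:
  assumes "run P" "P \<noteq> []"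
  shows "run_part P # gamma Q \<preceq> gamma (P @ Q)"
  using assms
proof (induction P)
  case (Cons B P)
  show ?case
  proof (cases "0 \<in> B")
    case True
    then show ?thesis using Cons.prems by (simp add: run_Cons_fermionic run_part_def fermionic_def)
  next
    case False
    show ?thesis
    proof (cases "P = []")
      case P: True
      show ?thesis
      proof (cases "Q \<noteq> [] \<and> 0 \<notin> hd Q")
        case True
        then obtain k \<beta> where k: "gamma Q = Undotted (Suc k) # \<beta>" by (elim conjE gamma_nonfermionic_head)
        have "dcovers (Undotted (Suc (Suc k)) # \<beta>) (Undotted 1 # Undotted (Suc k) # \<beta>)"
          using dcovers.intros[of 1 "Suc k" "[]" \<beta>] by simp
        then have "Undotted 1 # Undotted (Suc k) # \<beta> \<preceq> Undotted (Suc (Suc k)) # \<beta>"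
          by (auto simp: dle_def)
        with False P k show ?thesis by (simp add: gamma_Cons run_part_def fermionic_def)
      qed (use False P in \<open>auto simp: gamma_Cons run_part_def fermionic_def\<close>)
    next
      case P: False
      then have P': "run P" "0 \<notin> hd P" "the_elem B \<le> the_elem (hd P)"
        using Cons.prems False by (simp_all add: run_Cons_nonfermionic)
      obtain k \<beta> where k: "gamma (P @ Q) = Undotted (Suc k) # \<beta>"
        using P P' by (metis append_is_Nil_conv gamma_nonfermionic_head hd_append2)
      have "bump (Undotted (length P) # gamma Q) \<preceq> bump (gamma (P @ Q))"
        using dle_bump[of "Undotted (length P) # gamma Q" "Suc k" \<beta>] Cons.IH[OF P'(1) P] P'(2)
        by (simp add: k run_part_def fermionic_def)
      then show ?thesis using False P P' by (simp add: gamma_Cons run_part_def fermionic_def)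
    qed
  qed
qed simp

text \<open>The witness is the longest first run: it ends at the first descent, next to a fermionic
  block, or with the list.\<close>

lemma gamma_eq_run_part:
  assumes "I \<noteq> []"
  shows "\<exists>P Q. (P, Q) \<in> splits I \<and> P \<noteq> [] \<and> gamma I = run_part P # gamma Q"
  using assms
proof (induction I)
  case (Cons B I)
  show ?case
  proof (cases "0 \<in> B")
    case True
    then show ?thesis
      by (intro exI[of _ "[B]"] exI[of _ I]) (simp add: splits_def run_Cons_fermionic run_part_def fermionic_def)
  next
    case False
    show ?thesis
    proof (cases "I \<noteq> [] \<and> 0 \<notin> hd I \<and> the_elem B \<le> the_elem (hd I)")
      case True
      then obtain P Q where PQ: "P @ Q = I" "run P" "P \<noteq> []" "gamma I = run_part P # gamma Q"
        using Cons.IH by (auto simp: splits_def)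
      moreover have "hd I = hd P" using PQ by auto
      ultimately have "(B # P, Q) \<in> splits I'"
          "gamma I' = run_part (B # P) # gamma Q" if "I' = B # I" for I'
        using False True that
        by (simp_all add: splits_def run_Cons_nonfermionic gamma_Cons run_part_def fermionic_def)
      then show ?thesis by blast
    next
      case F: False
      then show ?thesis using False
        by (intro exI[of _ "[B]"] exI[of _ I])
          (auto simp: splits_def run_Cons_nonfermionic gamma_Cons run_part_def fermionic_def)
    qed
  qed
qed simp

lemma run_append:
  assumes "run (P @ Q)"
  shows "run P" "run Q"
proof -
  have "run P \<and> run Q"
  proof (cases "\<exists>B. 0 \<in> B \<and> P @ Q = [B]")
    case True
    then show ?thesis using assms by (auto simp: append_eq_Cons_conv)
  next
    case False
    then show ?thesis using assms unfolding run_def successively_append_iff by auto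
  qed
  then show "run P" "run Q" by simp_all
qed

text \<open>A dotted part comes from a one-block run and an undotted part counts blocks; hence a
  part alone fixes where the first run of a given list ends.\<close>

lemma run_part_length:
  assumes "run P"
  shows "length P = (case run_part P of Dotted _ \<Rightarrow> 1 | Undotted k \<Rightarrow> k)"
  using assms by (cases P) (auto simp: run_part_def fermionic_def run_Cons_fermionic)

text \<open>
  The first part of a refinement of \<open>\<gamma>(I)\<close> is the type of a unique nonempty first run of
  \<open>I\<close>; this turns the sum over refinements into the recursion of \<open>L_trunc\<close>.
\<close>

lemma Cons_dle_gamma_iff:
  "p # \<beta> \<preceq> gamma I \<longleftrightarrow>
     (\<exists>P Q. (P, Q) \<in> splits I \<and> P \<noteq> [] \<and> p = run_part P \<and> \<beta> \<preceq> gamma Q)"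
proof
  assume "\<exists>P Q. (P, Q) \<in> splits I \<and> P \<noteq> [] \<and> p = run_part P \<and> \<beta> \<preceq> gamma Q"
  then show "p # \<beta> \<preceq> gamma I"
    using dle_Cons dle_trans run_part_gamma_dle by (fastforce simp: splits_def)
next
  assume le: "p # \<beta> \<preceq> gamma I"
  \<comment> \<open>Induction along the chain of covers needs an arbitrary list, so head and tail
    replace the pattern \<open>p # \<beta>\<close>.\<close>
  have "\<alpha> \<preceq> gamma I \<Longrightarrow> \<alpha> \<noteq> [] \<Longrightarrow>
      \<exists>P Q. (P, Q) \<in> splits I \<and> P \<noteq> [] \<and> hd \<alpha> = run_part P \<and> tl \<alpha> \<preceq> gamma Q" for \<alpha>
    unfolding dle_def
  proof (induction rule: converse_rtranclp_induct)
    case base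
    then have "I \<noteq> []" by auto
    from gamma_eq_run_part[OF this] show ?case by force
  next
    case (step \<alpha> \<alpha>1)
    have "\<alpha>1 \<noteq> []" using step(1) by (auto elim: dcovers.cases)
    then obtain q \<beta>1 where \<alpha>1: "\<alpha>1 = q # \<beta>1" by (cases \<alpha>1) auto
    then obtain P Q where PQ: "(P, Q) \<in> splits I" "P \<noteq> []" "q = run_part P" "\<beta>1 \<preceq> gamma Q"
      using step by (auto simp: dle_def)
    from step(1)[unfolded \<alpha>1] show ?case
    proof (cases rule: dcovers_ConsE)
      case (1 \<alpha>')
      then have "\<alpha>' \<preceq> gamma Q"
        using PQ(4) by (auto simp: dle_def intro: converse_rtranclp_into_rtranclp)
      with 1 PQ show ?thesis by (auto simp: dle_def)
    next
      case (2 a b)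
      then have nf: "\<not> fermionic P" "length P = a + b"
        using PQ(3) by (auto simp: run_part_def split: if_splits)
      \<comment> \<open>Splitting the first part into \<open>a\<close> and \<open>b\<close> cuts the
        run \<open>P\<close> after \<open>a\<close> blocks; the second piece passes to the remaining
        list \<open>P2 @ Q\<close>.\<close>
      define P1 P2 where "P1 = take a P" and "P2 = drop a P"
      have P: "P = P1 @ P2" "length P1 = a" "length P2 = b" using nf by (auto simp: P1_def P2_def)
      have r: "run P" "P @ Q = I" using PQ by (auto simp: splits_def)
      have run: "run P1" "run P2" using r(1) unfolding P(1) by (auto dest: run_append)
      have "P2 \<noteq> []" "P1 \<noteq> []" using P 2 by auto
      have "\<forall>B\<in>set P. 0 \<notin> B" using r nf by (auto simp: run_def fermionic_def)
      then have "\<not> fermionic P1" "\<not> fermionic P2" using P \<open>P1 \<noteq> []\<close> \<open>P2 \<noteq> []\<close>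
        by (auto simp: fermionic_def)
      then have parts: "run_part P1 = Undotted a" "run_part P2 = Undotted b"
        using P by (auto simp: run_part_def)
      have "Undotted b # \<beta>1 \<preceq> gamma (P2 @ Q)"
        using dle_trans[OF dle_Cons[OF PQ(4)] run_part_gamma_dle[OF run(2) \<open>P2 \<noteq> []\<close>]] parts by simp
      moreover have "(P1, P2 @ Q) \<in> splits I" using r P run by (simp add: splits_def)
      ultimately show ?thesis using 2 parts \<open>P1 \<noteq> []\<close> by (auto simp: dle_def intro!: exI)
    qed
  qed
  from this[OF le] show "\<exists>P Q. (P, Q) \<in> splits I \<and> P \<noteq> [] \<and> p = run_part P \<and> \<beta> \<preceq> gamma Q"
    by simp
qed

lemma splits_run_part_inj:
  assumes "(P, Q) \<in> splits I" "(P', Q') \<in> splits I" "run_part P = run_part P'"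
  shows "P = P' \<and> Q = Q'"
proof -
  have "length P = length P'"
    using assms run_part_length by (simp add: splits_def)
  then show ?thesis using assms by (auto simp: splits_def)
qed

section \<open>The functions L in finitely many variables\<close>

text \<open>Defined on \<open>I\<close> rather than on \<open>gamma I\<close>, because
  super-shuffles combine blocks. \<open>P\<close> collects the blocks that get the variable
  \<open>v\<close>, possibly none.\<close>

primrec L_trunc :: "nat list \<Rightarrow> nat set list \<Rightarrow> superseries" where
  "L_trunc [] I = (if I = [] then 1 else 0)"
| "L_trunc (v # vs) I = (\<Sum>(P, Q)\<in>splits I. wt v (run_part P) * L_trunc vs Q)"

lemma Nil_dle_gamma: "[] \<preceq> gamma I \<longleftrightarrow> I = []"
proof
  assume "[] \<preceq> gamma I"
  then have "gamma I = []"
    unfolding dle_def by (auto elim!: converse_rtranclpE dcovers.cases)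
  then show "I = []" using gamma_eq_run_part[of I] by auto
qed simp

lemma wt_run_part_Nil [simp]: "wt v (run_part []) = 1"
  by (simp add: wt_def run_part_def fermionic_def)

lemma L_trunc_eq: "L_trunc vs I = (\<Sum>\<beta> | \<beta> \<preceq> gamma I. M_trunc vs \<beta>)"
proof (induction vs arbitrary: I)
  case Nil
  have "(\<Sum>\<beta> | \<beta> \<preceq> gamma I. M_trunc [] \<beta>) = (\<Sum>\<beta>\<in>{\<beta>. \<beta> \<preceq> gamma I} \<inter> {[]}. 1)"
    using finite_dle[OF dotted_composition_gamma, of I]
    by (simp add: sum.inter_restrict cong: sum.cong)
  also have "\<dots> = L_trunc [] I"
    by (auto simp: Nil_dle_gamma Int_insert_right)
  finally show ?case ..
next
  case (Cons v vs)
  let ?D = "\<lambda>I. {\<beta>. \<beta> \<preceq> gamma I}"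
  have fin: "finite (?D I)" for I by (rule finite_dle[OF dotted_composition_gamma])
  let ?g = "\<lambda>\<beta>. case \<beta> of [] \<Rightarrow> 0 | p # \<beta>' \<Rightarrow> wt v p * M_trunc vs \<beta>'"
  \<comment> \<open>The split with empty first run is set apart: it matches the summand of
    \<open>M_trunc\<close> that leaves out \<open>v\<close>. The other splits match the refinements
    sorted by their first part.\<close>
  let ?S = "splits I - {([], I)}"
  let ?T = "Sigma ?S (\<lambda>(P, Q). ?D Q)"
  have S: "P \<noteq> []" "(P, Q) \<in> splits I" if "(P, Q) \<in> ?S" for P Q
    using that by (auto simp: splits_def)
  have S': "(P, Q) \<in> ?S" if "(P, Q) \<in> splits I" "P \<noteq> []" for P Q
    using that by auto
  let ?f = "\<lambda>((P, Q), \<beta>). run_part P # \<beta>"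
  have inj: "inj_on ?f ?T"
    by (rule inj_onI) (clarsimp, metis splits_run_part_inj)
  have img: "?f ` ?T = ?D I - {[]}"
  proof (intro set_eqI iffI)
    fix \<alpha> assume "\<alpha> \<in> ?f ` ?T"
    then obtain P Q \<beta> where "(P, Q) \<in> ?S" "\<beta> \<preceq> gamma Q" and \<alpha>: "\<alpha> = run_part P # \<beta>"
      by auto
    then have "run_part P # \<beta> \<preceq> gamma I" using S unfolding Cons_dle_gamma_iff by blast
    then show "\<alpha> \<in> ?D I - {[]}" using \<alpha> by simp
  next
    fix \<alpha> assume \<alpha>: "\<alpha> \<in> ?D I - {[]}"
    then obtain p \<beta> where p: "\<alpha> = p # \<beta>" by (cases \<alpha>) auto
    with \<alpha> obtain P Q where "(P, Q) \<in> splits I" "P \<noteq> []" "p = run_part P" "\<beta> \<preceq> gamma Q"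
      by (auto simp: Cons_dle_gamma_iff)
    then have "((P, Q), \<beta>) \<in> ?T" "\<alpha> = ?f ((P, Q), \<beta>)" using S' p by auto
    then show "\<alpha> \<in> ?f ` ?T" by blast
  qed
  have "(\<Sum>\<beta>\<in>?D I. ?g \<beta>) = (\<Sum>\<beta>\<in>?D I - {[]}. ?g \<beta>)"
    by (rule sum.mono_neutral_right) (use fin in auto)
  also have "\<dots> = (\<Sum>x\<in>?T. ?g (?f x))"
    unfolding img[symmetric] using sum.reindex[OF inj, of ?g] by (simp add: o_def)
  also have "\<dots> = (\<Sum>((P, Q), \<beta>)\<in>?T. wt v (run_part P) * M_trunc vs \<beta>)"
    by (rule sum.cong) auto
  also have "\<dots> = (\<Sum>s\<in>?S. \<Sum>\<beta>\<in>?D (snd s). wt v (run_part (fst s)) * M_trunc vs \<beta>)"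
    by (subst sum.Sigma) (use fin in \<open>auto simp: case_prod_unfold\<close>)
  also have "\<dots> = (\<Sum>(P, Q)\<in>?S. wt v (run_part P) * L_trunc vs Q)"
    by (simp add: Cons.IH sum_distrib_left case_prod_unfold)
  finally have g: "(\<Sum>\<beta>\<in>?D I. ?g \<beta>) = (\<Sum>(P, Q)\<in>?S. wt v (run_part P) * L_trunc vs Q)" .
  have "([], I) \<in> splits I" by (simp add: splits_def)
  then have "L_trunc (v # vs) I = L_trunc vs I + (\<Sum>(P, Q)\<in>?S. wt v (run_part P) * L_trunc vs Q)"
    by (simp add: sum.remove)
  also have "\<dots> = (\<Sum>\<beta>\<in>?D I. M_trunc vs \<beta> + ?g \<beta>)"
    by (simp only: g[symmetric] sum.distrib Cons.IH[of I])
  finally show ?case by simp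
qed

lemma agree_L_trunc: "agree N (L (gamma I)) (L_trunc [0..<N] I)"
  unfolding L_def L_trunc_eq
  by (rule agree_sum) (use agree_M_trunc dle_invariants dotted_composition_gamma in auto)


section \<open>First runs of super-shuffles\<close>

definition side :: "origin \<Rightarrow> block list \<Rightarrow> nat set list" where
  "side o' S = map snd (filter (\<lambda>b. fst b = o') S)"

lemma side_simps [simp]:
  "side o' [] = []"
  "side o' (b # S) = (if fst b = o' then snd b # side o' S else side o' S)"
  "side o' (S @ T) = side o' S @ side o' T"
  "side o' (map (Pair o') P) = P"
  "o'' \<noteq> o' \<Longrightarrow> side o' (map (Pair o'') P) = []"
  by (simp_all add: side_def filter_map o_def)

text \<open>The origins keep the two sequences apart, so being a shuffle is tested by
  filtering.\<close>

lemma shuffles_iff_side: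
  "S \<in> shuffles (map (Pair FromI) A) (map (Pair FromJ) C) \<longleftrightarrow> side FromI S = A \<and> side FromJ S = C"
proof (induction S arbitrary: A C)
  case (Cons b S)
  obtain o' B where b: "b = (o', B)" by (cases b)
  have I: "S \<in> shuffles (tl (map (Pair FromI) A)) (map (Pair FromJ) C) \<longleftrightarrow>
      side FromI S = tl A \<and> side FromJ S = C"
    using Cons.IH[of "tl A" C] by (simp add: map_tl)
  have J: "S \<in> shuffles (map (Pair FromI) A) (tl (map (Pair FromJ) C)) \<longleftrightarrow>
      side FromI S = A \<and> side FromJ S = tl C"
    using Cons.IH[of A "tl C"] by (simp add: map_tl)
  show ?case
    unfolding b Cons_in_shuffles_iff I J by (cases o'; cases A; cases C) auto
qed auto

text \<open>Keeps of a superpermutation what passes to its pieces; being a superpermutation does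
  not, as the letters must exhaust an interval. Distinct letters make weak and strict increase
  agree.\<close>

definition wf_side :: "nat \<Rightarrow> origin \<Rightarrow> nat set list \<Rightarrow> bool" where
  "wf_side n o' P \<longleftrightarrow> (\<forall>B\<in>set P. wf_block n (o', B)) \<and> distinct (filter (\<lambda>B. 0 \<notin> B) P)"

lemma wf_side_append:
  assumes "wf_side n o' (P @ Q)"
  shows "wf_side n o' P" "wf_side n o' Q"
  using assms by (auto simp: wf_side_def)

lemma wf_side_blocks:
  assumes "wf_side n FromI (side FromI S)" "wf_side n FromJ (side FromJ S)"
  shows "\<forall>b\<in>set S. wf_block n b"
proof
  fix b assume b: "b \<in> set S"
  obtain o' B where "b = (o', B)" by (cases b)
  then show "wf_block n b"
    using assms b by (cases o') (force simp: wf_side_def side_def)+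
qed

lemma wf_block_letter:
  assumes "wf_block n (o', B)" "0 \<notin> B"
  shows "\<exists>a. B = {a} \<and> a \<noteq> 0 \<and> (a \<le> n \<longleftrightarrow> o' = FromI)"
proof -
  obtain a where "B = {a}" using assms by (auto simp: wf_block_def is_singleton_def)
  then show ?thesis using assms by (auto simp: wf_block_def split: if_splits)
qed

lemma wf_side_letters:
  assumes "wf_side n o' P" "\<forall>B\<in>set P. 0 \<notin> B"
  obtains as where "P = map (\<lambda>a. {a}) as" "distinct as"
    "\<forall>a\<in>set as. a \<noteq> 0 \<and> (a \<le> n \<longleftrightarrow> o' = FromI)"
proof -
  have *: "B = {the_elem B} \<and> the_elem B \<noteq> 0 \<and> (the_elem B \<le> n \<longleftrightarrow> o' = FromI)"
    if "B \<in> set P" for B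
  proof -
    have "wf_block n (o', B)" "0 \<notin> B" using assms that by (auto simp: wf_side_def)
    from wf_block_letter[OF this] show ?thesis by (metis the_elem_eq)
  qed
  have "filter (\<lambda>B. 0 \<notin> B) P = P" using assms by simp
  then have "distinct P" using assms(1) by (simp add: wf_side_def)
  moreover have P: "P = map (\<lambda>a. {a}) (map the_elem P)"
    using * by (simp add: map_idI)
  ultimately have "distinct (map the_elem P)" by (metis distinct_map)
  with P * show thesis by (intro that[of "map the_elem P"]) auto
qed

lemma run_nonfermionic: "run P \<Longrightarrow> \<not> fermionic P \<Longrightarrow> \<forall>B\<in>set P. 0 \<notin> B"
  by (auto simp: run_def fermionic_def)

lemma run_fermionic: "run P \<Longrightarrow> fermionic P \<Longrightarrow> \<exists>F. P = [F] \<and> 0 \<in> F"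
  by (cases P) (auto simp: run_def fermionic_def)

lemma run_successively: "run P \<Longrightarrow> successively (\<lambda>B C. the_elem B \<le> the_elem C) P"
  by (auto simp: run_def)

lemma nonfermionic_iff: "\<forall>B\<in>set P. 0 \<notin> B \<Longrightarrow> \<not> fermionic P"
  by (auto simp: fermionic_def)

lemma increasing_iff_run:
  assumes "wf_side n o' P"
  shows "increasing P \<longleftrightarrow> run P \<and> \<not> fermionic P"
proof (cases "\<forall>B\<in>set P. 0 \<notin> B")
  case True
  then obtain as where P: "P = map (\<lambda>a. {a}) as" and d: "distinct as"
    using wf_side_letters[OF assms] by metis
  have "increasing P \<longleftrightarrow> successively (<) as"
    using True by (simp add: increasing_def P successively_map)
  also have "\<dots> \<longleftrightarrow> sorted as"
    using d by (simp add: successively_conv_sorted_wrt strict_sorted_iff)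
  also have "\<dots> \<longleftrightarrow> successively (\<le>) as"
    by (simp add: successively_conv_sorted_wrt)
  also have "\<dots> \<longleftrightarrow> run P"
    using True by (auto simp: run_def P successively_map)
  finally show ?thesis using True nonfermionic_iff by blast
next
  case False
  then show ?thesis using run_nonfermionic by (auto simp: increasing_def)
qed

text \<open>Letters from \<open>I\<close> are at most \<open>n\<close> and those from
  \<open>J[n]\<close> exceed \<open>n\<close>, so without a descent no block of \<open>J[n]\<close>
  can precede one of \<open>I\<close>.\<close>

lemma run_eq_sides:
  assumes "\<forall>b\<in>set S. wf_block n b" "\<forall>b\<in>set S. 0 \<notin> snd b" "run (map snd S)"
  shows "S = map (Pair FromI) (side FromI S) @ map (Pair FromJ) (side FromJ S)"
  using assms
proof (induction S)
  case (Cons b S)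
  obtain o' B where b: "b = (o', B)" by (cases b)
  have B: "0 \<notin> B" "wf_block n (o', B)" using Cons.prems b by auto
  have S: "S = map (Pair FromI) (side FromI S) @ map (Pair FromJ) (side FromJ S)"
    using Cons by (cases S) (auto simp: b run_Cons_nonfermionic)
  show ?case
  proof (cases o')
    case FromI
    then show ?thesis using S b by simp
  next
    case FromJ
    have "side FromI S = []"
    proof (rule ccontr)
      assume "side FromI S \<noteq> []"
      then obtain D Ds where "side FromI S = D # Ds" by (cases "side FromI S") auto
      then obtain S' where S': "S = (FromI, D) # S'" using S by auto
      then have "0 \<notin> D" "wf_block n (FromI, D)" "the_elem B \<le> the_elem D"
        using Cons.prems b by (auto simp: run_Cons_nonfermionic)
      then show False
        using wf_block_letter[OF B(2,1)] wf_block_letter[of n FromI D] FromJ by auto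
    qed
    then show ?thesis using S b FromJ by simp
  qed
qed simp

text \<open>
  The blocks of a super-shuffle with smallest index \<open>v\<close>, when those of \<open>I\<close> and
  \<open>J[n]\<close> are \<open>P\<close> and \<open>P'\<close>. In each case the shuffle before the mergers has
  \<open>P\<close> first, then \<open>P'\<close>. The value is meaningless if both runs are fermionic.
\<close>

definition merge_runs :: "nat set list \<Rightarrow> nat set list \<Rightarrow> block list" where
  "merge_runs P P' =
     (if fermionic P then [(FromI, \<Union>(set (P @ P')))]
      else if fermionic P' then [(FromJ, \<Union>(set (P @ P')))]
      else map (Pair FromI) P @ map (Pair FromJ) P')"

section \<open>Mergers and first runs\<close>

lemma merges_to_refl: "merges_to S S"
  unfolding merges_to_def
proof (intro exI conjI)
  show "concat (map (\<lambda>b. [b]) S) = S" by simp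
  show "list_all2 merge_run (map (\<lambda>b. [b]) S) S"
    by (simp add: list_all2_conv_all_nth merge_run.keep)
qed

lemma merges_to_single: "merge_run S b \<Longrightarrow> merges_to S [b]"
  unfolding merges_to_def by (intro exI[of _ "[S]"]) simp

lemma merges_to_append:
  "merges_to S (R @ K) \<longleftrightarrow> (\<exists>S1 S2. S = S1 @ S2 \<and> merges_to S1 R \<and> merges_to S2 K)"
proof
  assume "merges_to S (R @ K)"
  then obtain Rs where "concat Rs = S" "list_all2 merge_run Rs (R @ K)"
    by (auto simp: merges_to_def)
  then show "\<exists>S1 S2. S = S1 @ S2 \<and> merges_to S1 R \<and> merges_to S2 K"
    unfolding merges_to_def list_all2_append2 by (elim exE conjE) (metis concat_append)
next
  assume "\<exists>S1 S2. S = S1 @ S2 \<and> merges_to S1 R \<and> merges_to S2 K"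
  then show "merges_to S (R @ K)"
    by (auto simp: merges_to_def) (metis concat_append list_all2_appendI)
qed

lemma merges_to_merge_runs:
  assumes "wf_side n FromI P" "wf_side n FromJ P'" "run P" "run P'" "\<not> (fermionic P \<and> fermionic P')"
  shows "merges_to (map (Pair FromI) P @ map (Pair FromJ) P') (merge_runs P P')"
    and "run (map snd (merge_runs P P'))"
proof -
  let ?S = "map (Pair FromI) P @ map (Pair FromJ) P'"
  have "merges_to ?S (merge_runs P P') \<and> run (map snd (merge_runs P P'))"
  proof (cases "fermionic P")
    case True
    then obtain F where F: "P = [F]" "0 \<in> F" using run_fermionic assms by blast
    have "increasing P'" using assms True increasing_iff_run by blast
    from merge_run.mergeI[OF F(2) this] show ?thesis
      using F True by (auto simp: merge_runs_def run_Cons_fermionic intro: merges_to_single)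
  next
    case nf: False
    show ?thesis
    proof (cases "fermionic P'")
      case True
      then obtain F where F: "P' = [F]" "0 \<in> F" using run_fermionic assms by blast
      have "increasing P" using assms nf increasing_iff_run by blast
      from merge_run.mergeJ[OF F(2) this] show ?thesis
        using F True nf by (auto simp: merge_runs_def run_Cons_fermionic intro: merges_to_single)
    next
      case False
      have 0: "\<forall>B\<in>set P. 0 \<notin> B" "\<forall>B\<in>set P'. 0 \<notin> B"
        using run_nonfermionic nf False assms by blast+
      \<comment> \<open>The junction of the two runs is an ascent, since its letters lie on
        different sides of \<open>n\<close>.\<close>
      have "the_elem (last P) \<le> the_elem (hd P')" if "P \<noteq> []" "P' \<noteq> []"
      proof -
        have "last P \<in> set P" "hd P' \<in> set P'" using that by auto
        then have "wf_block n (FromI, last P)" "wf_block n (FromJ, hd P')" "0 \<notin> last P" "0 \<notin> hd P'"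
          using assms 0 by (auto simp: wf_side_def)
        then show ?thesis
          using wf_block_letter[of n FromI "last P"] wf_block_letter[of n FromJ "hd P'"] by auto
      qed
      moreover have "successively (\<lambda>B C. the_elem B \<le> the_elem C) P"
          "successively (\<lambda>B C. the_elem B \<le> the_elem C) P'"
        using assms(3,4) run_successively by blast+
      ultimately have "run (P @ P')"
        using 0 unfolding run_def successively_append_iff set_append by blast
      with nf False show ?thesis by (simp add: merge_runs_def merges_to_refl o_def)
    qed
  qed
  then show "merges_to ?S (merge_runs P P')" "run (map snd (merge_runs P P'))" by simp_all
qed

text \<open>Both merger rules create a block containing 0, so a result without such blocks arose
  with \<open>keep\<close> alone.\<close>

lemma merges_to_nonfermionic:
  assumes "merges_to S R" "\<forall>b\<in>set R. 0 \<notin> snd b"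
  shows "S = R"
proof -
  obtain Rs where "concat Rs = S" "list_all2 merge_run Rs R"
    using assms(1) by (auto simp: merges_to_def)
  moreover have "list_all2 merge_run Rs R \<Longrightarrow> \<forall>b\<in>set R. 0 \<notin> snd b \<Longrightarrow> concat Rs = R"
    by (induction rule: list_all2_induct) (auto elim!: merge_run.cases)
  ultimately show ?thesis using assms(2) by simp
qed

text \<open>Converse of \<open>merges_to_merge_runs\<close>. A run of singletons was touched by no
  merger and is handled by \<open>run_eq_sides\<close>; a fermionic run is one block, so a single
  rule of \<open>merge_run\<close> made it.\<close>

lemma merges_to_runD:
  assumes "merges_to S R" "run (map snd R)"
    and wf: "wf_side n FromI (side FromI S)" "wf_side n FromJ (side FromJ S)"
  shows "run (side FromI S)" "run (side FromJ S)"
    "\<not> (fermionic (side FromI S) \<and> fermionic (side FromJ S))"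
    "R = merge_runs (side FromI S) (side FromJ S)"
    "S = map (Pair FromI) (side FromI S) @ map (Pair FromJ) (side FromJ S)"
proof -
  let ?P = "side FromI S" and ?P' = "side FromJ S"
  have "run ?P \<and> run ?P' \<and> \<not> (fermionic ?P \<and> fermionic ?P') \<and> R = merge_runs ?P ?P' \<and>
      S = map (Pair FromI) ?P @ map (Pair FromJ) ?P'"
  proof (cases "fermionic (map snd R)")
    case False
    then have R: "\<forall>b\<in>set R. 0 \<notin> snd b" using run_nonfermionic[OF assms(2)] by auto
    have SR: "S = R" by (rule merges_to_nonfermionic[OF assms(1) R])
    have S: "S = map (Pair FromI) ?P @ map (Pair FromJ) ?P'"
      using run_eq_sides[OF wf_side_blocks[OF wf]] R assms(2) SR by simp
    have "map snd S = ?P @ ?P'" by (subst S) (simp add: o_def)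
    then have "run (?P @ ?P')" using SR assms(2) by simp
    moreover have "\<forall>B\<in>set (?P @ ?P'). 0 \<notin> B" using R SR by (auto simp: side_def)
    moreover from this have "\<not> fermionic ?P" "\<not> fermionic ?P'"
      by (auto intro!: nonfermionic_iff)
    moreover from this have "merge_runs ?P ?P' = map (Pair FromI) ?P @ map (Pair FromJ) ?P'"
      by (simp add: merge_runs_def)
    ultimately show ?thesis using run_append S SR by metis
  next
    case True
    then obtain b where b: "R = [b]" "0 \<in> snd b"
      using run_fermionic[OF assms(2)] by auto
    then have "merge_run S b"
      using assms(1) by (auto simp: merges_to_def list_all2_Cons2)
    then show ?thesis
    proof cases
      case keep
      obtain o' B where "b = (o', B)" by (cases b)
      then show ?thesis using keep b
        by (cases o') (auto simp: merge_runs_def fermionic_def run_Cons_fermionic)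
    next
      case (mergeI F Bs)
      have "run Bs \<and> \<not> fermionic Bs" using increasing_iff_run[OF wf(2)] mergeI by simp
      then show ?thesis
        using mergeI b by (auto simp: merge_runs_def fermionic_def run_Cons_fermionic)
    next
      case (mergeJ F Bs)
      have "run Bs \<and> \<not> fermionic Bs" using increasing_iff_run[OF wf(1)] mergeJ by simp
      then show ?thesis
        using mergeJ b by (auto simp: merge_runs_def fermionic_def run_Cons_fermionic)
    qed
  qed
  then show "run ?P" "run ?P'" "\<not> (fermionic ?P \<and> fermionic ?P')" "R = merge_runs ?P ?P'"
    "S = map (Pair FromI) ?P @ map (Pair FromJ) ?P'" by blast+
qed

section \<open>Signs of shuffles\<close>

definition num_fermionic :: "nat set list \<Rightarrow> nat" where
  "num_fermionic P = length (filter (\<lambda>B. 0 \<in> B) P)"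

lemma num_fermionic_simps [simp]:
  "num_fermionic [] = 0"
  "num_fermionic (B # P) = (if 0 \<in> B then Suc (num_fermionic P) else num_fermionic P)"
  "num_fermionic (P @ Q) = num_fermionic P + num_fermionic Q"
  by (simp_all add: num_fermionic_def)

lemma part_dot_run_part:
  assumes "run P"
  shows "part_dot (run_part P) = num_fermionic P"
proof (cases "fermionic P")
  case True
  then show ?thesis using run_fermionic[OF assms] by (auto simp: run_part_def)
next
  case False
  then show ?thesis using run_nonfermionic[OF assms] by (simp add: run_part_def num_fermionic_def)
qed

text \<open>The pairs counted by \<open>eps\<close> are sorted by whether their first position is
  that of \<open>b\<close>; all others are pairs of \<open>S\<close> with both positions moved by
  one.\<close>

lemma eps_Cons:
  "eps (b # S) =
     (if fst b = FromJ \<and> 0 \<in> snd b then num_fermionic (side FromI S) else 0) + eps S"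
proof -
  let ?J = "\<lambda>b :: block. fst b = FromJ \<and> 0 \<in> snd b" and ?I = "\<lambda>b :: block. fst b = FromI \<and> 0 \<in> snd b"
  let ?A = "{q. q < length S \<and> ?I (S ! q)}"
  let ?E = "{(p, q). p < q \<and> q < length S \<and> fst (S ! p) = FromJ \<and> 0 \<in> snd (S ! p) \<and>
       fst (S ! q) = FromI \<and> 0 \<in> snd (S ! q)}"
  let ?E' = "{(p, q). p < q \<and> q < length (b # S) \<and> fst ((b # S) ! p) = FromJ \<and> 0 \<in> snd ((b # S) ! p) \<and>
       fst ((b # S) ! q) = FromI \<and> 0 \<in> snd ((b # S) ! q)}"
  have fin: "finite ?E"
    by (rule finite_subset[of _ "{..<length S} \<times> {..<length S}"]) auto
  have "?E' = (\<lambda>q. (0, Suc q)) ` (if ?J b then ?A else {}) \<union> map_prod Suc Suc ` ?E"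
    (is "_ = ?X \<union> ?Y")
  proof (intro set_eqI iffI)
    fix x assume x: "x \<in> ?E'"
    then obtain p q where pq: "x = (p, Suc q)" "p \<le> q" by (cases x; cases "snd x") auto
    show "x \<in> ?X \<union> ?Y"
    proof (cases p)
      case 0
      then show ?thesis using x pq by auto
    next
      case (Suc p')
      then have "x = map_prod Suc Suc (p', q)" "(p', q) \<in> ?E" using x pq by auto
      then show ?thesis by blast
    qed
  qed (auto split: if_splits)
  moreover have "?X \<inter> ?Y = {}" by auto
  ultimately have "card ?E' = card ?X + card ?Y"
    using fin by (simp only:) (rule card_Un_disjoint; simp)
  moreover have "card ?X = (if ?J b then card ?A else 0)"
    by (simp add: card_image inj_on_def)
  moreover have "card ?Y = card ?E" by (intro card_image) (auto simp: inj_on_def)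
  moreover have "num_fermionic (side FromI S) = card ?A"
    by (simp add: num_fermionic_def side_def filter_map o_def length_filter_conv_card conj_commute)
  ultimately show ?thesis unfolding eps_def by simp
qed

lemma eps_Nil [simp]: "eps [] = 0"
  by (simp add: eps_def)

text \<open>Within the first run \<open>P\<close> precedes \<open>P'\<close>, so the only new
  inversions pair fermionic blocks of \<open>P'\<close> with fermionic blocks of \<open>I\<close> in
  \<open>S\<close>.\<close>

lemma eps_runs:
  "eps (map (Pair FromI) P @ map (Pair FromJ) P' @ S) =
     num_fermionic P' * num_fermionic (side FromI S) + eps S"
proof -
  have "eps (map (Pair FromJ) P' @ S) = num_fermionic P' * num_fermionic (side FromI S) + eps S"
    by (induction P') (simp_all add: eps_Cons)
  moreover have "eps (map (Pair FromI) P @ T) = eps T" for T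
    by (induction P) (simp_all add: eps_Cons)
  ultimately show ?thesis by simp
qed


section \<open>The product formula\<close>

lemma Theta_squared: "Theta v * Theta v = 0"
  by (rule coeff_inject[THEN iffD1], rule ext)
    (simp add: Theta_def coeff_smonom_mult mdisj_def)

lemma wt_mult:
  "wt v p * wt v q =
     (if part_dot p + part_dot q = 2 then 0
      else Theta v ^ (part_dot p + part_dot q) * X v ^ (part_val p + part_val q))"
proof -
  have "X v ^ part_val p * Theta v ^ part_dot q = Theta v ^ part_dot q * X v ^ part_val p"
    by (metis X_Theta_commute power_commuting_commutes)
  then have "wt v p * wt v q =
      Theta v ^ part_dot p * Theta v ^ part_dot q * (X v ^ part_val p * X v ^ part_val q)"
    unfolding wt_def by (metis mult.assoc)
  also have "\<dots> = Theta v ^ (part_dot p + part_dot q) * X v ^ (part_val p + part_val q)"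
    by (simp add: power_add)
  finally show ?thesis using Theta_squared[of v] by (auto simp: power2_eq_square)
qed

lemma wf_side_Union:
  assumes "wf_side n o' P" "\<forall>B\<in>set P. 0 \<notin> B"
  shows "finite (\<Union>(set P))" "card (\<Union>(set P)) = length P"
    "a \<in> \<Union>(set P) \<Longrightarrow> a \<noteq> 0 \<and> (a \<le> n \<longleftrightarrow> o' = FromI)"
proof -
  from assms obtain as where P: "P = map (\<lambda>a. {a}) as" "distinct as"
      "\<forall>a\<in>set as. a \<noteq> 0 \<and> (a \<le> n \<longleftrightarrow> o' = FromI)"
    using wf_side_letters by metis
  then have "\<Union>(set P) = set as" by auto
  then show "finite (\<Union>(set P))" "card (\<Union>(set P)) = length P"
    "a \<in> \<Union>(set P) \<Longrightarrow> a \<noteq> 0 \<and> (a \<le> n \<longleftrightarrow> o' = FromI)"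
    using P by (auto simp: distinct_card)
qed

lemma card_fermionic_Un:
  assumes "0 \<in> F" "finite F" "finite U" "F \<inter> U = {}"
  shows "card (F \<union> U) - 1 = card F - 1 + card U"
proof -
  \<comment> \<open>The truncated subtraction is exact because \<open>F\<close> contains 0 and is
    finite.\<close>
  have "card F \<noteq> 0" using assms by auto
  moreover have "card (F \<union> U) = card F + card U" using assms by (simp add: card_Un_disjoint)
  ultimately show ?thesis by simp
qed

text \<open>Two fermionic runs produce the square of a theta, which is 0. Otherwise the exponents of
  x add up: an absorbing fermionic block is disjoint from the letters it receives, as these lie on
  the other side of \<open>n\<close>.\<close>

lemma wt_merge_runs:
  assumes wf: "wf_side n FromI P" "wf_side n FromJ P'" and run: "run P" "run P'"
  shows "wt v (run_part P) * wt v (run_part P') =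
    (if fermionic P \<and> fermionic P' then 0 else wt v (run_part (map snd (merge_runs P P'))))"
proof (cases "fermionic P")
  case True
  then obtain F where F: "P = [F]" "0 \<in> F" using run_fermionic run by blast
  show ?thesis
  proof (cases "fermionic P'")
    case False
    note U = wf_side_Union[OF wf(2) run_nonfermionic[OF run(2) False]]
    have "F \<subseteq> {..n}" "finite F" using wf F by (auto simp: wf_side_def wf_block_def)
    then have "card (F \<union> \<Union>(set P')) - 1 = card F - 1 + length P'"
      using card_fermionic_Un[OF F(2) _ U(1)] U(2,3) by fastforce
    then show ?thesis
      using F True False by (simp add: wt_mult run_part_def merge_runs_def) (simp add: wt_def fermionic_def)
  qed (use True in \<open>simp add: wt_mult run_part_def\<close>)
next
  case nf: False
  show ?thesis
  proof (cases "fermionic P'")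
    case True
    then obtain F where F: "P' = [F]" "0 \<in> F" using run_fermionic run by blast
    note U = wf_side_Union[OF wf(1) run_nonfermionic[OF run(1) nf]]
    have "F \<inter> {1..n} = {}" "finite F" using wf F by (auto simp: wf_side_def wf_block_def)
    moreover have "\<Union>(set P) \<subseteq> {1..n}" using U(3) by force
    ultimately have "finite F" "F \<inter> \<Union>(set P) = {}" by blast+
    then have "card (F \<union> \<Union>(set P)) - 1 = card F - 1 + length P"
      using card_fermionic_Un[OF F(2) _ U(1)] U(2) by simp
    then show ?thesis
      using F True nf by (simp add: wt_mult run_part_def merge_runs_def)
        (simp add: wt_def fermionic_def Un_commute add.commute)
  next
    case False
    have "\<not> fermionic (P @ P')"
      using run_nonfermionic nf False run by (intro nonfermionic_iff) auto
    then show ?thesis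
      using nf False by (simp add: wt_mult run_part_def merge_runs_def o_def) (simp add: wt_def)
  qed
qed

lemma wt_commute_X: "wt w q * X v = X v * wt w q"
proof -
  have "X w ^ a * X v = X v * X w ^ a" for a by (metis X_commute power_commuting_commutes)
  moreover have "Theta w ^ d * X v = X v * Theta w ^ d" for d
    by (metis X_Theta_commute power_commuting_commutes)
  ultimately show ?thesis unfolding wt_def by (metis mult.assoc)
qed

lemma wt_commute_Theta: "wt w q * Theta v = (-1) ^ part_dot q * (Theta v * wt w q)"
proof -
  have X: "X w ^ a * Theta v = Theta v * X w ^ a" for a
    by (metis X_Theta_commute power_commuting_commutes)
  show ?thesis
  proof (cases q)
    case (Dotted a)
    have "Theta w * X w ^ a * Theta v = (Theta w * Theta v) * X w ^ a"
      by (simp add: X mult.assoc)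
    also have "\<dots> = - (Theta v * (Theta w * X w ^ a))"
      by (simp add: Theta_anticommute[of w v] mult.assoc)
    finally show ?thesis by (simp add: wt_def Dotted)
  qed (simp add: wt_def X)
qed

lemma L_trunc_commute_X: "L_trunc vs Q * X v = X v * L_trunc vs Q"
proof (induction vs arbitrary: Q)
  case (Cons w vs)
  have "wt w p * L_trunc vs Q * X v = X v * (wt w p * L_trunc vs Q)" for p Q
    by (metis Cons.IH mult.assoc wt_commute_X)
  then show ?case by (simp add: sum_distrib_left sum_distrib_right case_prod_unfold)
qed simp

text \<open>Each term of \<open>L_trunc vs Q\<close> carries one theta per fermionic block of
  \<open>Q\<close>, and \<open>Theta v\<close> anticommutes with all of them, also with
  itself.\<close>

lemma L_trunc_commute_Theta:
  "L_trunc vs Q * Theta v = (-1) ^ num_fermionic Q * (Theta v * L_trunc vs Q)"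
proof (induction vs arbitrary: Q)
  case (Cons w vs)
  have "wt w (run_part P) * L_trunc vs R * Theta v =
      (-1) ^ num_fermionic Q * (Theta v * (wt w (run_part P) * L_trunc vs R))"
    if "(P, R) \<in> splits Q" for P R
  proof -
    have "num_fermionic Q = num_fermionic P + num_fermionic R" "part_dot (run_part P) = num_fermionic P"
      using that part_dot_run_part by (auto simp: splits_def)
    then have nQ: "(-1 :: superseries) ^ num_fermionic Q =
        (-1) ^ num_fermionic R * (-1) ^ part_dot (run_part P)"
      by (simp add: power_add minus_one_power_iff)
    \<comment> \<open>Signs are central although the ring is not commutative.\<close>
    have c: "f * ((-1) ^ k * g) = (-1) ^ k * (f * g)" for f g :: superseries and k
      by (simp add: minus_one_power_iff)
    have "wt w (run_part P) * L_trunc vs R * Theta v =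
        (-1) ^ num_fermionic R * (wt w (run_part P) * Theta v * L_trunc vs R)"
      by (simp add: mult.assoc Cons.IH c)
    also have "\<dots> = (-1) ^ num_fermionic Q * (Theta v * (wt w (run_part P) * L_trunc vs R))"
      by (simp add: wt_commute_Theta nQ mult.assoc)
    finally show ?thesis .
  qed
  then show ?case by (auto simp: sum_distrib_left sum_distrib_right intro!: sum.cong)
qed simp

lemma L_trunc_commute_wt:
  "L_trunc vs Q * wt v p = (-1) ^ (part_dot p * num_fermionic Q) * (wt v p * L_trunc vs Q)"
proof -
  have X: "L_trunc vs Q * X v ^ a = X v ^ a * L_trunc vs Q" for a
    by (metis L_trunc_commute_X power_commuting_commutes)
  show ?thesis
  proof (cases p)
    case (Dotted a)
    have "L_trunc vs Q * (Theta v * X v ^ a) =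
        (-1) ^ num_fermionic Q * (Theta v * (L_trunc vs Q * X v ^ a))"
      by (simp only: mult.assoc[symmetric] L_trunc_commute_Theta)
    then show ?thesis by (simp add: wt_def Dotted X mult.assoc)
  qed (simp add: wt_def X)
qed

section \<open>Cutting super-shuffles after a first run\<close>

text \<open>Here \<open>C\<close> is already shifted, so that the induction can pass to the rests of
  both lists without renumbering.\<close>

definition SSh_lists :: "nat set list \<Rightarrow> nat set list \<Rightarrow> block list set" where
  "SSh_lists A C = {K. \<exists>S. side FromI S = A \<and> side FromJ S = C \<and> merges_to S K}"

lemma SSh_eq: "SSh n I J = SSh_lists I (map (shift_block n) J)"
  unfolding SSh_def SSh_lists_def IJ_shuffles_def Bex_def shuffles_iff_side conj_assoc ..

text \<open>Explicit form of the shuffle behind a super-shuffle, in place of the description in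
  \<open>ssgn\<close>; it can be computed piece by piece.\<close>

definition unmerge :: "nat \<Rightarrow> block list \<Rightarrow> block list" where
  "unmerge n K = concat (map (split_block n) K)"

lemma unmerge_append: "unmerge n (R @ K) = unmerge n R @ unmerge n K"
  by (simp add: unmerge_def)

lemma SSh_lists_unmerge:
  assumes "wf_side n FromI A" "wf_side n FromJ C"
  shows "K \<in> SSh_lists A C \<longleftrightarrow>
    side FromI (unmerge n K) = A \<and> side FromJ (unmerge n K) = C \<and> merges_to (unmerge n K) K"
proof
  assume "K \<in> SSh_lists A C"
  then obtain S where S: "side FromI S = A" "side FromJ S = C" "merges_to S K"
    by (auto simp: SSh_lists_def)
  then have "S = unmerge n K"
    unfolding unmerge_def by (intro merges_to_split wf_side_blocks) (use assms in auto)
  with S show "side FromI (unmerge n K) = A \<and> side FromJ (unmerge n K) = C \<and> merges_to (unmerge n K) K"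
    by simp
qed (auto simp: SSh_lists_def)

lemma finite_SSh_lists:
  assumes "wf_side n FromI A" "wf_side n FromJ C"
  shows "finite (SSh_lists A C)"
proof -
  let ?Sh = "{S. side FromI S = A \<and> side FromJ S = C}"
  have "finite {K. merges_to S K}" if "S \<in> ?Sh" for S
  proof (rule finite_subset)
    have "finite (\<Union>(snd ` set S))"
      using wf_side_blocks[of n S] assms that by (auto simp: wf_block_def)
    then show "finite {K. set K \<subseteq> {FromI, FromJ} \<times> Pow (\<Union>(snd ` set S)) \<and> length K \<le> length S}"
      by (intro finite_lists_length_le) simp
    show "{K. merges_to S K}
        \<subseteq> {K. set K \<subseteq> {FromI, FromJ} \<times> Pow (\<Union>(snd ` set S)) \<and> length K \<le> length S}"
      using merges_to_bound by blast
  qed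
  moreover have "finite ?Sh"
    using finite_shuffles[of "map (Pair FromI) A" "map (Pair FromJ) C"]
    by (simp add: shuffles_iff_side[symmetric])
  moreover have "SSh_lists A C = (\<Union>S\<in>?Sh. {K. merges_to S K})"
    by (auto simp: SSh_lists_def)
  ultimately show ?thesis by simp
qed

lemma unmerge_merge_runs:
  assumes "wf_side n FromI P" "wf_side n FromJ P'" "run P" "run P'" "\<not> (fermionic P \<and> fermionic P')"
  shows "unmerge n (merge_runs P P') = map (Pair FromI) P @ map (Pair FromJ) P'"
  unfolding unmerge_def
  by (rule merges_to_split[OF merges_to_merge_runs(1)[OF assms], symmetric], rule wf_side_blocks)
    (use assms in simp_all)

text \<open>Marking a first run \<open>R\<close> of a super-shuffle also cuts the underlying shuffle
  (\<open>merges_to_append\<close>); the front piece consists of one run of each factor, combined by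
  \<open>merge_runs\<close>. Injectivity holds because \<open>unmerge\<close> recovers both
  runs.\<close>

lemma first_run_bijection:
  assumes wf: "wf_side n FromI A" "wf_side n FromJ C"
  defines "Z \<equiv> {(x, y) \<in> splits A \<times> splits C. \<not> (fermionic (fst x) \<and> fermionic (fst y))}"
  shows "bij_betw (\<lambda>((x, y), K). (merge_runs (fst x) (fst y), K))
    (Sigma Z (\<lambda>(x, y). SSh_lists (snd x) (snd y)))
    {(R, K). R @ K \<in> SSh_lists A C \<and> run (map snd R)}" (is "bij_betw ?f ?D ?W")
proof (rule bij_betw_imageI)
  have D: "wf_side n FromI P" "wf_side n FromI Q" "wf_side n FromJ P'" "wf_side n FromJ Q'"
      "run P" "run P'" "\<not> (fermionic P \<and> fermionic P')" "P @ Q = A" "P' @ Q' = C" "K \<in> SSh_lists Q Q'"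
    if "((((P, Q), (P', Q')), K)) \<in> ?D" for P Q P' Q' K
    using that wf wf_side_append[of n _ P Q] wf_side_append[of n _ P' Q']
    by (auto simp: Z_def splits_def)
  show "inj_on ?f ?D"
  proof (rule inj_onI)
    fix d e assume d: "d \<in> ?D" and e: "e \<in> ?D" and eq: "?f d = ?f e"
    obtain P Q P' Q' K where d': "d = (((P, Q), (P', Q')), K)" by (metis prod.exhaust)
    obtain P1 Q1 P1' Q1' K1 where e': "e = (((P1, Q1), (P1', Q1')), K1)" by (metis prod.exhaust)
    note Dd = D[OF d[unfolded d']] and De = D[OF e[unfolded e']]
    have "merge_runs P P' = merge_runs P1 P1'" "K = K1" using eq d' e' by auto
    then have "map (Pair FromI) P @ map (Pair FromJ) P' = map (Pair FromI) P1 @ map (Pair FromJ) P1'"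
      using unmerge_merge_runs[OF Dd(1,3,5-7)] unmerge_merge_runs[OF De(1,3,5-7)] by simp
    from arg_cong[OF this, of "side FromI"] arg_cong[OF this, of "side FromJ"]
    have "P = P1" "P' = P1'" by simp_all
    with Dd De \<open>K = K1\<close> show "d = e" by (auto simp: d' e')
  qed
  show "?f ` ?D = ?W"
  proof (intro set_eqI iffI)
    fix w assume "w \<in> ?f ` ?D"
    then obtain P Q P' Q' K where d: "(((P, Q), (P', Q')), K) \<in> ?D" and w: "w = (merge_runs P P', K)"
      by force
    note Dd = D[OF d]
    obtain S where S: "side FromI S = Q" "side FromJ S = Q'" "merges_to S K"
      using Dd(10) by (auto simp: SSh_lists_def)
    note m = merges_to_merge_runs[OF Dd(1,3,5-7)]
    have "merges_to ((map (Pair FromI) P @ map (Pair FromJ) P') @ S) (merge_runs P P' @ K)"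
      unfolding merges_to_append using m(1) S(3) by blast
    moreover have "side FromI ((map (Pair FromI) P @ map (Pair FromJ) P') @ S) = A"
        "side FromJ ((map (Pair FromI) P @ map (Pair FromJ) P') @ S) = C"
      using S Dd by simp_all
    ultimately have "merge_runs P P' @ K \<in> SSh_lists A C" unfolding SSh_lists_def by blast
    then show "w \<in> ?W" using m(2) w by simp
  next
    fix w assume "w \<in> ?W"
    then obtain R K where w: "w = (R, K)" "R @ K \<in> SSh_lists A C" "run (map snd R)" by auto
    then obtain S1 S2 where S: "side FromI (S1 @ S2) = A" "side FromJ (S1 @ S2) = C"
        "merges_to S1 R" "merges_to S2 K"
      by (auto simp: SSh_lists_def merges_to_append)
    have wf1: "wf_side n FromI (side FromI S1)" "wf_side n FromJ (side FromJ S1)"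
      using wf S(1,2) wf_side_append(1) by (metis side_simps(3))+
    note m = merges_to_runD[OF S(3) w(3) wf1]
    let ?d = "(((side FromI S1, side FromI S2), (side FromJ S1, side FromJ S2)), K)"
    have "?d \<in> ?D"
      using S m(1-3) by (auto simp: Z_def splits_def SSh_lists_def)
    moreover have "w = ?f ?d" using m(4) w by simp
    ultimately show "w \<in> ?f ` ?D" by (rule rev_image_eqI)
  qed
qed

text \<open>\<open>L_trunc\<close> forgets the origins while \<open>SSh_lists\<close> needs them. A
  split is fixed by the length of its first piece, so the origins can be restored.\<close>

lemma sum_splits_map_snd:
  "(\<Sum>(P, Q)\<in>splits (map snd K). g P Q) =
     (\<Sum>(R, K')\<in>{(R, K'). R @ K' = K \<and> run (map snd R)}. g (map snd R) (map snd K'))"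
proof (rule sum.reindex_bij_witness[symmetric,
    where j = "\<lambda>(R, K'). (map snd R, map snd K')" and
      i = "\<lambda>(P, Q). (take (length P) K, drop (length P) K)"])
  fix x assume "x \<in> splits (map snd K)"
  then obtain P Q where x: "x = (P, Q)" "P @ Q = map snd K" "run P" by (auto simp: splits_def)
  then have "P = map snd (take (length P) K)" "Q = map snd (drop (length P) K)"
    by (metis append_eq_conv_conj take_map, metis append_eq_conv_conj drop_map)
  with x show "(\<lambda>(R, K'). (map snd R, map snd K')) ((\<lambda>(P, Q). (take (length P) K, drop (length P) K)) x) = x"
    "(\<lambda>(P, Q). (take (length P) K, drop (length P) K)) x \<in> {(R, K'). R @ K' = K \<and> run (map snd R)}"
    by auto
qed (auto simp: splits_def)

lemma finite_splits_tagged [simp]: "finite {(R, K'). R @ K' = K \<and> run (map snd R)}"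
proof (rule finite_subset)
  show "{(R, K'). R @ K' = K \<and> run (map snd R)} \<subseteq> (\<lambda>i. (take i K, drop i K)) ` {..length K}"
  proof clarify
    fix R K' assume "K = R @ K'"
    then have "(R, K') = (take (length R) (R @ K'), drop (length R) (R @ K'))" "length R \<le> length (R @ K')"
      by auto
    then show "(R, K') \<in> (\<lambda>i. (take i (R @ K'), drop i (R @ K'))) ` {..length (R @ K')}" by blast
  qed
qed simp

lemma L_trunc_mult:
  assumes "wf_side n FromI A" "wf_side n FromJ C"
  shows "L_trunc vs A * L_trunc vs C =
    (\<Sum>K\<in>SSh_lists A C. (-1) ^ eps (unmerge n K) * L_trunc vs (map snd K))"
  using assms
proof (induction vs arbitrary: A C)
  case Nil
  have N: "K \<in> SSh_lists A C \<and> K = [] \<longleftrightarrow> K = [] \<and> A = [] \<and> C = []" for K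
    by (auto simp: SSh_lists_def merges_to_def)
  have "(\<Sum>K\<in>SSh_lists A C. (-1) ^ eps (unmerge n K) * L_trunc [] (map snd K)) =
      (\<Sum>K\<in>SSh_lists A C. if K = [] then 1 else 0)"
    by (rule sum.cong) (auto simp: unmerge_def)
  also have "\<dots> = (if [] \<in> SSh_lists A C then 1 else 0)"
    using finite_SSh_lists[OF Nil] by simp
  also have "\<dots> = L_trunc [] A * L_trunc [] C" using N[of "[]"] by simp
  finally show ?case ..
next
  case (Cons v vs)
  note wf = Cons.prems
  define Z where "Z = {(x, y) \<in> splits A \<times> splits C. \<not> (fermionic (fst x) \<and> fermionic (fst y))}"
  \<comment> \<open>The signed term of the super-shuffle \<open>R @ K\<close> in which exactly the
    blocks of \<open>R\<close> get the variable \<open>v\<close>.\<close>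
  define h where "h R K = (-1) ^ eps (unmerge n (R @ K)) * (wt v (run_part (map snd R)) * L_trunc vs (map snd K))"
    for R K :: "block list"
  let ?W = "{(R, K). R @ K \<in> SSh_lists A C \<and> run (map snd R)}"
  let ?T = "\<lambda>K. {(R, K'). R @ K' = K \<and> run (map snd R)}"
  have finZ: "finite Z"
    by (rule finite_subset[of _ "splits A \<times> splits C"]) (auto simp: Z_def)
  have product: "wt v (run_part P) * L_trunc vs Q * (wt v (run_part P') * L_trunc vs Q') =
      (if fermionic P \<and> fermionic P' then 0 else \<Sum>K\<in>SSh_lists Q Q'. h (merge_runs P P') K)"
    if "(P, Q) \<in> splits A" "(P', Q') \<in> splits C" for P Q P' Q'
  proof -
    have PQ: "P @ Q = A" "P' @ Q' = C" "run P" "run P'" using that by (auto simp: splits_def)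
    have wf': "wf_side n FromI P" "wf_side n FromI Q" "wf_side n FromJ P'" "wf_side n FromJ Q'"
      using wf PQ wf_side_append[of n _ P Q] wf_side_append[of n _ P' Q'] by auto
    \<comment> \<open>The sign from moving the weight of \<open>P'\<close> past
      \<open>L_trunc vs Q\<close>; its exponent is the one that \<open>eps_runs\<close> produces for
      the first run.\<close>
    define s where "s = (-1 :: superseries) ^ (num_fermionic P' * num_fermionic Q)"
    have c: "f * (s * g) = s * (f * g)" for f g
      by (simp add: s_def minus_one_power_iff)
    have "wt v (run_part P) * L_trunc vs Q * (wt v (run_part P') * L_trunc vs Q') =
        wt v (run_part P) * (L_trunc vs Q * wt v (run_part P')) * L_trunc vs Q'"
      by (simp add: mult.assoc)
    also have "\<dots> = s * (wt v (run_part P) * wt v (run_part P')) * (L_trunc vs Q * L_trunc vs Q')"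
      by (simp add: L_trunc_commute_wt part_dot_run_part[OF PQ(4)] s_def[symmetric] c mult.assoc)
    also have "\<dots> = (if fermionic P \<and> fermionic P' then 0
        else s * wt v (run_part (map snd (merge_runs P P'))) * (L_trunc vs Q * L_trunc vs Q'))"
      by (simp add: wt_merge_runs[OF wf'(1,3) PQ(3,4)])
    also have "\<dots> = (if fermionic P \<and> fermionic P' then 0 else \<Sum>K\<in>SSh_lists Q Q'. h (merge_runs P P') K)"
    proof (cases "fermionic P \<and> fermionic P'")
      case False
      have "s * wt v (run_part (map snd (merge_runs P P'))) *
            ((-1) ^ eps (unmerge n K) * L_trunc vs (map snd K)) = h (merge_runs P P') K"
        if "K \<in> SSh_lists Q Q'" for K
      proof -
        have "side FromI (unmerge n K) = Q"
          using that SSh_lists_unmerge[OF wf'(2,4)] by simp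
        then have "eps (unmerge n (merge_runs P P' @ K)) =
            num_fermionic P' * num_fermionic Q + eps (unmerge n K)"
          by (simp add: unmerge_append unmerge_merge_runs[OF wf'(1,3) PQ(3,4) False] eps_runs)
        then show ?thesis
          by (simp add: h_def s_def power_add) (simp add: minus_one_power_iff)
      qed
      then show ?thesis
        by (simp add: False Cons.IH[OF wf'(2,4)] sum_distrib_left)
    qed simp
    finally show ?thesis .
  qed
  have "L_trunc (v # vs) A * L_trunc (v # vs) C =
      (\<Sum>(x, y)\<in>splits A \<times> splits C. if fermionic (fst x) \<and> fermionic (fst y) then 0
        else \<Sum>K\<in>SSh_lists (snd x) (snd y). h (merge_runs (fst x) (fst y)) K)"
    by (simp add: sum_product sum.cartesian_product case_prod_unfold)
      (rule sum.cong[OF refl], use product in \<open>auto simp: case_prod_unfold\<close>)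
  \<comment> \<open>Pairs of fermionic runs contribute 0 and are dropped, which leaves the domain of
    the bijection.\<close>
  also have "\<dots> = (\<Sum>xy\<in>Z. \<Sum>K\<in>SSh_lists (snd (fst xy)) (snd (snd xy)).
      h (merge_runs (fst (fst xy)) (fst (snd xy))) K)"
    unfolding Z_def by (rule sum.mono_neutral_cong_right) (auto split: if_splits)
  also have "\<dots> = (\<Sum>(xy, K)\<in>Sigma Z (\<lambda>xy. SSh_lists (snd (fst xy)) (snd (snd xy))).
      h (merge_runs (fst (fst xy)) (fst (snd xy))) K)"
  proof (rule sum.Sigma[OF finZ], rule ballI)
    fix xy assume "xy \<in> Z"
    then have "fst (fst xy) @ snd (fst xy) = A" "fst (snd xy) @ snd (snd xy) = C"
      by (auto simp: Z_def splits_def)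
    then show "finite (SSh_lists (snd (fst xy)) (snd (snd xy)))"
      using wf wf_side_append(2) by (intro finite_SSh_lists[of n]) metis+
  qed
  also have "\<dots> = (\<Sum>(R, K)\<in>?W. h R K)"
    using sum.reindex_bij_betw[OF first_run_bijection[OF wf], of "\<lambda>(R, K). h R K"]
    by (simp add: Z_def case_prod_unfold)
  \<comment> \<open>The terms are regrouped by the whole super-shuffle; the inner sum over its first
    runs is then the recursion of \<open>L_trunc\<close>.\<close>
  also have "\<dots> = (\<Sum>(K, (R, K'))\<in>Sigma (SSh_lists A C) ?T. h R K')"
    by (rule sum.reindex_bij_witness[where j = "\<lambda>(R, K). (R @ K, (R, K))" and i = snd]) auto
  also have "\<dots> = (\<Sum>K\<in>SSh_lists A C. \<Sum>(R, K')\<in>?T K. h R K')"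
    using finite_SSh_lists[OF wf] by (subst sum.Sigma) auto
  also have "\<dots> = (\<Sum>K\<in>SSh_lists A C. (-1) ^ eps (unmerge n K) * L_trunc (v # vs) (map snd K))"
    by (rule sum.cong) (auto simp: sum_splits_map_snd sum_distrib_left h_def intro!: sum.cong)
  finally show ?case .
qed

section \<open>Back to superpermutations and full series\<close>

lemma zero_in_shift_block [simp]: "0 \<in> shift_block n B \<longleftrightarrow> 0 \<in> B"
  by (auto simp: shift_block_def)

lemma inj_shift: "inj (\<lambda>a. if a = 0 then 0 else a + n :: nat)"
  by (auto simp: inj_on_def split: if_splits)

text \<open>The shift keeps cardinalities, the element 0 and the order of the letters, and
  \<open>gamma\<close> depends on nothing else.\<close>

lemma gamma_shift:
  assumes "\<forall>B\<in>set J. 0 \<notin> B \<longrightarrow> is_singleton B"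
  shows "gamma (map (shift_block n) J) = gamma J"
  using assms
proof (induction J)
  case (Cons B J)
  have card: "card (shift_block n B) = card B"
    unfolding shift_block_def by (intro card_image inj_on_subset[OF inj_shift]) simp
  have elem: "the_elem (shift_block n D) = the_elem D + n" if "0 \<notin> D" "D \<in> set (B # J)" for D
  proof -
    have "is_singleton D" using Cons.prems that by blast
    then obtain a where "D = {a}" by (rule is_singletonE)
    then show ?thesis using that by (simp add: shift_block_def)
  qed
  show ?case
  proof (cases "0 \<in> B")
    case False
    have "gamma (map (shift_block n) J) = gamma J" using Cons by simp
    moreover have "the_elem (shift_block n B) \<le> the_elem (shift_block n (hd J)) \<longleftrightarrow>
        the_elem B \<le> the_elem (hd J)" if "J \<noteq> []" "0 \<notin> hd J"
      using elem[of B] elem[of "hd J"] False that by simp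
    ultimately show ?thesis
      using False by (simp add: gamma_Cons hd_map cong: conj_cong)
  qed (use Cons card in simp)
qed simp

text \<open>Two equal blocks without 0 at different positions would meet inside \<open>{0}\<close>,
  hence be empty.\<close>

lemma superpermutation_distinct:
  assumes "superpermutation n m I"
  shows "distinct (filter (\<lambda>B. 0 \<notin> B) I)"
proof -
  have I: "\<forall>B\<in>set I. B \<noteq> {}" "\<forall>i<length I. \<forall>j<length I. i \<noteq> j \<longrightarrow> I ! i \<inter> I ! j \<subseteq> {0}"
    using assms by (auto simp: superpermutation_def set_supercomposition_def)
  have "\<forall>i<length I. \<forall>j<length I. i \<noteq> j \<longrightarrow> I ! i \<inter> I ! j \<subseteq> {0} \<Longrightarrow> \<forall>B\<in>set I. B \<noteq> {} \<Longrightarrow>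
      distinct (filter (\<lambda>B. 0 \<notin> B) I)" for I :: "nat set list"
  proof (induction I)
    case (Cons B I)
    have "I ! i \<inter> I ! j \<subseteq> {0}" if "i < length I" "j < length I" "i \<noteq> j" for i j
      using Cons.prems(1)[rule_format, of "Suc i" "Suc j"] that by simp
    then have "distinct (filter (\<lambda>B. 0 \<notin> B) I)"
      using Cons.prems(2) by (intro Cons.IH) auto
    moreover have "B \<notin> set I" if "0 \<notin> B"
    proof
      assume "B \<in> set I"
      then obtain j where "j < length I" "I ! j = B" by (auto simp: in_set_conv_nth)
      then have "B \<inter> B \<subseteq> {0}"
        using Cons.prems(1)[rule_format, of 0 "Suc j"] by simp
      then show False using that Cons.prems(2) by auto
    qed
    ultimately show ?case by auto
  qed simp
  with I show ?thesis by blast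
qed

lemma superpermutation_wf_side:
  assumes "superpermutation n m I" "superpermutation n' m' J"
  shows "wf_side n FromI I" "wf_side n FromJ (map (shift_block n) J)"
proof -
  \<comment> \<open>Any one shuffle contains all blocks of both sequences, so it transfers
    \<open>wf_block_IJ_shuffles\<close> to them.\<close>
  obtain S where S: "S \<in> IJ_shuffles n I J"
    using splice_in_shuffles unfolding IJ_shuffles_def by blast
  have "\<forall>b\<in>set S. wf_block n b" using wf_block_IJ_shuffles[OF assms S] by blast
  moreover have "set S = Pair FromI ` set I \<union> Pair FromJ ` shift_block n ` set J"
    using set_shuffles[OF S[unfolded IJ_shuffles_def]] by (simp add: image_image)
  ultimately have "\<forall>B\<in>set I. wf_block n (FromI, B)" "\<forall>B\<in>set J. wf_block n (FromJ, shift_block n B)"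
    by auto
  moreover have "distinct (filter (\<lambda>B. 0 \<notin> B) (map (shift_block n) J))"
  proof -
    have "inj (shift_block n)"
      by (rule injI) (simp only: shift_block_def inj_image_eq_iff[OF inj_shift])
    then have "inj_on (shift_block n) A" for A by (rule inj_on_subset) simp
    then show ?thesis
      using superpermutation_distinct[OF assms(2)]
      by (simp add: filter_map o_def distinct_map)
  qed
  ultimately show "wf_side n FromI I" "wf_side n FromJ (map (shift_block n) J)"
    using superpermutation_distinct[OF assms(1)] by (auto simp: wf_side_def)
qed

lemma ssgn_eq:
  assumes "superpermutation n m I" "superpermutation n' m' J" "K \<in> SSh n I J"
  shows "ssgn n I J K = (-1) ^ eps (unmerge n K)"
proof -
  have "unmerge n K \<in> IJ_shuffles n I J \<and> merges_to (unmerge n K) K"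
    using assms(3)
    unfolding SSh_eq IJ_shuffles_def shuffles_iff_side
      SSh_lists_unmerge[OF superpermutation_wf_side[OF assms(1,2)]] by blast
  then have "(THE S. S \<in> IJ_shuffles n I J \<and> merges_to S K) = unmerge n K"
    using SSh_unique_shuffle[OF assms] by (blast intro: the1_equality)
  then show ?thesis by (simp add: ssgn_def)
qed

lemma L_mult:
  assumes IJ: "superpermutation n m I" "superpermutation n' m' J"
  shows "L (gamma I) * L (gamma J) =
    (\<Sum>K\<in>SSh n I J. of_int (ssgn n I J K) * L (gamma (blocks K)))"
proof (rule agree_eqI)
  fix N
  let ?J = "map (shift_block n) J" and ?vs = "[0..<N]"
  \<comment> \<open>\<open>J\<close> may be replaced by its shift, whose letters lie above those of
    \<open>I\<close>.\<close>
  have "gamma ?J = gamma J"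
    using IJ(2) by (intro gamma_shift) (simp add: superpermutation_def)
  then have "agree N (L (gamma I) * L (gamma J)) (L_trunc ?vs I * L_trunc ?vs ?J)"
    using agree_mult[OF agree_L_trunc[of N I] agree_L_trunc[of N ?J]] by simp
  also have "L_trunc ?vs I * L_trunc ?vs ?J =
      (\<Sum>K\<in>SSh n I J. (-1) ^ eps (unmerge n K) * L_trunc ?vs (map snd K))"
    unfolding SSh_eq by (rule L_trunc_mult[OF superpermutation_wf_side[OF IJ]])
  also have "\<dots> = (\<Sum>K\<in>SSh n I J. of_int (ssgn n I J K) * L_trunc ?vs (blocks K))"
    using ssgn_eq[OF IJ] by (intro sum.cong) (simp_all add: blocks_def)
  finally have "agree N (L (gamma I) * L (gamma J))
      (\<Sum>K\<in>SSh n I J. of_int (ssgn n I J K) * L_trunc ?vs (blocks K))" .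
  moreover have "agree N (\<Sum>K\<in>SSh n I J. of_int (ssgn n I J K) * L (gamma (blocks K)))
      (\<Sum>K\<in>SSh n I J. of_int (ssgn n I J K) * L_trunc ?vs (blocks K))"
    by (intro agree_sum agree_mult agree_refl agree_L_trunc)
  ultimately show "agree N (L (gamma I) * L (gamma J))
      (\<Sum>K\<in>SSh n I J. of_int (ssgn n I J K) * L (gamma (blocks K)))"
    by (simp add: agree_def)
qed

theorem theorem5p12:
  fixes \<alpha> \<beta> :: "part list"
  assumes "dotted_composition \<alpha>" and "dotted_composition \<beta>"
  shows "(\<forall>n m n' m' I J.
            superpermutation n m I \<and> superpermutation n' m' J \<and>
            gamma I = \<alpha> \<and> gamma J = \<beta> \<longrightarrow>
            L \<alpha> * L \<beta> =
              (\<Sum>K\<in>SSh n I J. of_int (ssgn n I J K) * L (gamma (blocks K)))) \<and>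
         (\<forall>n m n' m' I J p q p' q' I' J'.
            superpermutation n m I \<and> superpermutation n' m' J \<and>
            gamma I = \<alpha> \<and> gamma J = \<beta> \<and>
            superpermutation p q I' \<and> superpermutation p' q' J' \<and>
            gamma I' = \<alpha> \<and> gamma J' = \<beta> \<longrightarrow>
            (\<Sum>K\<in>SSh n I J. of_int (ssgn n I J K) * L (gamma (blocks K))) =
              (\<Sum>K\<in>SSh p I' J'. of_int (ssgn p I' J' K) * L (gamma (blocks K))))"
proof -
  have product: "L \<alpha> * L \<beta> = (\<Sum>K\<in>SSh n I J. of_int (ssgn n I J K) * L (gamma (blocks K)))"
    if "superpermutation n m I \<and> superpermutation n' m' J \<and> gamma I = \<alpha> \<and> gamma J = \<beta>"
    for n m n' m' I J
    using L_mult[of n m I n' m' J] that by simp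
  show ?thesis
  proof (intro conjI allI impI)
    fix n m n' m' I J p q p' q' I' J'
    assume "superpermutation n m I \<and> superpermutation n' m' J \<and> gamma I = \<alpha> \<and> gamma J = \<beta> \<and>
      superpermutation p q I' \<and> superpermutation p' q' J' \<and> gamma I' = \<alpha> \<and> gamma J' = \<beta>"
    \<comment> \<open>Both sums equal \<open>L \<alpha> * L \<beta>\<close>, in which the
      superpermutations do not occur.\<close>
    then show "(\<Sum>K\<in>SSh n I J. of_int (ssgn n I J K) * L (gamma (blocks K))) =
        (\<Sum>K\<in>SSh p I' J'. of_int (ssgn p I' J' K) * L (gamma (blocks K)))"
      using product[of n m I n' m' J] product[of p q I' p' q' J'] by simp
  qed (rule product)
qed

end
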